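(* Let $G$ be a simple graph with vertex set $\{1,\ldots,n\}$ and let $m\ge 2$ be an integer. Then $$\det W_Q(G\circ P_m)=\pm\,(\det Q(G))^{m-1}\,(\det W_Q(G))^m,$$ i.e. the two sides are equal up to sign.
   Context: For a graph $H$ on $N$ vertices with adjacency matrix $A(H)$ and diagonal degree matrix $D(H)$, the signless Laplacian matrix is $Q(H)=A(H)+D(H)$, and the $Q$-walk matrix is the $N\times N$ matrix $W_Q(H)=[e,Q(H)e,\ldots,Q(H)^{N-1}e]$, where $e\in\mathbb{R}^N$ is the all-one vector. $P_m$ is the path on $m$ vertices, rooted at an endvertex. The rooted product $G\circ P_m$ is the graph on $mn$ vertices obtained from $G$ and $n$ disjoint copies of $P_m$ by identifying, for each $i=1,\ldots,n$, vertex $i$ of $G$ with the root of the $i$-th copy of $P_m$. (Relabeling vertices changes $\det W_Q$ at most by a sign.) *)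

theory Defs
  imports
    Complex_Main
    "Graph_Theory.Pair_Digraph"
    "Jordan_Normal_Form.Determinant"
begin

text \<open>
  A finite simple graph is a term satisfying \<^locale>\<open>pair_graph\<close>: finite vertex set, and an
  irreflexive symmetric set of arcs, so that each undirected edge \<open>{u, v}\<close> is represented by the
  two arcs \<open>(u, v)\<close> and \<open>(v, u)\<close>. Hence the out-degree of a vertex is its undirected degree.

  The rows and columns of the matrices below are labelled by a list of vertices that enumerates
  the vertex set: index \<open>i\<close> belongs to the vertex \<open>vs ! i\<close>.
\<close>

definition vertex_enum :: "'a pair_pre_digraph \<Rightarrow> 'a list \<Rightarrow> bool" where
  "vertex_enum H vs \<longleftrightarrow> distinct vs \<and> set vs = pverts H"

definition adj_mat :: "'a pair_pre_digraph \<Rightarrow> 'a list \<Rightarrow> real mat" where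
  "adj_mat H vs = mat (length vs) (length vs) (\<lambda>(i, j). if (vs ! i, vs ! j) \<in> parcs H then 1 else 0)"

definition degree_mat :: "'a pair_pre_digraph \<Rightarrow> 'a list \<Rightarrow> real mat" where
  "degree_mat H vs = mat_diag (length vs) (\<lambda>i. real (out_degree (with_proj H) (vs ! i)))"

definition signless_laplacian :: "'a pair_pre_digraph \<Rightarrow> 'a list \<Rightarrow> real mat" where
  "signless_laplacian H vs = adj_mat H vs + degree_mat H vs"

definition all_ones :: "nat \<Rightarrow> real vec" where
  "all_ones N = vec N (\<lambda>_. 1)"

definition Q_walk_mat :: "'a pair_pre_digraph \<Rightarrow> 'a list \<Rightarrow> real mat" where
  "Q_walk_mat H vs = mat_of_cols (length vs)
     (map (\<lambda>k. (signless_laplacian H vs ^\<^sub>m k) *\<^sub>v all_ones (length vs)) [0..<length vs])"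

definition path_graph :: "nat \<Rightarrow> nat pair_pre_digraph" where
  "path_graph m = \<lparr>pverts = {1..m},
     parcs = {(a, b). a \<in> {1..m} \<and> b \<in> {1..m} \<and> (b = a + 1 \<or> a = b + 1)}\<rparr>"

text \<open>
  In the rooted product of \<open>G\<close> with a graph \<open>H\<close> rooted at \<open>r\<close>, the vertex \<open>(i, a)\<close> is the vertex
  \<open>a\<close> of the \<open>i\<close>-th copy of \<open>H\<close>; the root \<open>(i, r)\<close> of that copy is identified with the vertex \<open>i\<close>
  of \<open>G\<close>.
\<close>

definition rooted_product ::
    "'a pair_pre_digraph \<Rightarrow> 'b pair_pre_digraph \<Rightarrow> 'b \<Rightarrow> ('a \<times> 'b) pair_pre_digraph" where
  "rooted_product G H r = \<lparr>pverts = pverts G \<times> pverts H,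
     parcs = {((i, a), (i, b)) | i a b. i \<in> pverts G \<and> (a, b) \<in> parcs H} \<union>
             {((i, r), (j, r)) | i j. (i, j) \<in> parcs G}\<rparr>"

lemma pair_graph_path_graph: "pair_graph (path_graph m)"
proof
  show "finite (parcs (path_graph m))"
    by (rule finite_subset[of _ "{1..m} \<times> {1..m}"]) (auto simp: path_graph_def)
qed (auto simp: path_graph_def symmetric_def intro!: symI)

lemma pair_graph_rooted_product:
  assumes "pair_graph G" "pair_graph H" "r \<in> pverts H"
  shows "pair_graph (rooted_product G H r)"
proof -
  interpret G: pair_graph G by fact
  interpret H: pair_graph H by fact
  have wf: "fst e \<in> pverts (rooted_product G H r) \<and> snd e \<in> pverts (rooted_product G H r)"
    if "e \<in> parcs (rooted_product G H r)" for e
    using that assms(3)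
    by (auto simp: rooted_product_def dest: G.wellformed' H.wellformed')
  have fin: "finite (pverts (rooted_product G H r))"
    by (simp add: rooted_product_def G.pair_finite_verts H.pair_finite_verts)
  show ?thesis
  proof
    show "finite (parcs (rooted_product G H r))"
      by (rule finite_subset[OF _ finite_cartesian_product[OF fin fin]])
        (use wf in \<open>auto simp: mem_Times_iff\<close>)
    show "symmetric (with_proj (rooted_product G H r))"
      using G.pair_sym_arcs H.pair_sym_arcs
      by (auto simp: symmetric_def rooted_product_def intro!: symI dest: symD)
    show "fst e \<noteq> snd e" if "e \<in> parcs (rooted_product G H r)" for e
      using that by (auto simp: rooted_product_def dest: G.pair_no_loops H.pair_no_loops)
  qed (use wf fin in auto)
qed

end

theory Submission
  imports Defs "Jordan_Normal_Form.Char_Poly"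
begin

text \<open>
  Number the vertices of each copy of \<open>P\<^sub>m\<close> from the leaf towards the root. Then the signless Laplacian
  \<open>T\<close> of \<open>G \<circ> P\<^sub>m\<close> is block tridiagonal: it is the signless Laplacian of the path with every entry
  multiplied by the identity matrix of order \<open>n\<close>, plus \<open>Q = Q(G)\<close> in the last diagonal block. Write
  \<open>\<epsilon>\<^sub>k(y)\<close> for the vector with \<open>y\<close> in block \<open>k\<close>.

  There are monic integer polynomials \<open>q\<^sub>k\<close> of degree \<open>k\<close> with \<open>q\<^sub>k(T) \<epsilon>\<^sub>0(y) = \<epsilon>\<^sub>k(y)\<close> for \<open>k < m\<close>. Put
  \<open>g = q\<^sub>0 + \<dots> + q\<^sub>m\<^sub>-\<^sub>1\<close>, \<open>B = q\<^sub>m\<^sub>-\<^sub>1\<close> and \<open>A = q\<^sub>m + q\<^sub>m\<^sub>-\<^sub>1\<close>. The all-one vector is \<open>g(T) \<epsilon>\<^sub>0(e)\<close>, so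
  the walk matrix of \<open>T\<close> is \<open>g(T)\<close> times the walk matrix \<open>W\<close> that starts at \<open>\<epsilon>\<^sub>0(e)\<close>. This splits the claim.

  The factor \<open>(det Q)\<^sup>m\<^sup>-\<^sup>1\<close> is \<open>det g(T)\<close> up to sign. Block elimination gives \<open>det (T - c) = \<plusminus> det (B(c) Q - A(c))\<close> for
  every complex \<open>c\<close> (lemma \<open>det_rooted_mat_shift\<close>), and at each of the \<open>m - 1\<close> roots of \<open>g\<close> one has
  \<open>B = - 1\<close> and \<open>A = 0\<close> (lemma \<open>root_sum_path_poly\<close>).

  The factor \<open>(det W\<^sub>Q(G))\<^sup>m\<close> is \<open>det W\<close> up to sign. At the root, \<open>A(T) \<epsilon>\<^sub>0(y) = B(T) \<epsilon>\<^sub>0(Q y)\<close>, hence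
  \<open>A\<^sup>j B\<^sup>n\<^sup>-\<^sup>1\<^sup>-\<^sup>j q\<^sub>i\<close> maps \<open>\<epsilon>\<^sub>0(e)\<close> to \<open>B(T)\<^sup>n\<^sup>-\<^sup>1 \<epsilon>\<^sub>i(Q\<^sup>j e)\<close>. These \<open>m n\<close> polynomials form a basis over the
  integers of the polynomials of degree below \<open>m n\<close>, because \<open>A\<close> and \<open>B\<close> generate the unit ideal of
  \<open>\<int>[s]\<close> (lemmas \<open>homogeneous_expansion\<close>, \<open>det_walk_basis\<close>). So, up to a unimodular column operation,
  \<open>W\<close> is \<open>B(T)\<^sup>n\<^sup>-\<^sup>1\<close> times the block diagonal matrix with \<open>m\<close> blocks \<open>W\<^sub>Q(G)\<close>; and \<open>det B(T) = \<plusminus> 1\<close>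
  (lemma \<open>det_rooted_mat_path_poly\<close>), again by evaluating \<open>det (T - c)\<close> at roots.

  The argument works for an arbitrary complex matrix \<open>Q\<close> and vector \<open>e\<close> (lemma \<open>det_walk_mat_rooted\<close>).
\<close>

section \<open>Polynomials in a matrix and walk matrices\<close>

text \<open>
  The value \<open>p(M)\<close> of a polynomial at a square matrix, by Horner's scheme.
\<close>

definition mat_poly :: "'a :: comm_ring_1 mat \<Rightarrow> 'a poly \<Rightarrow> 'a mat" where
  "mat_poly M p = fold_coeffs (\<lambda>a X. a \<cdot>\<^sub>m 1\<^sub>m (dim_row M) + M * X) p (0\<^sub>m (dim_row M) (dim_row M))"

lemma mat_poly_dim [simp]:
  "dim_row (mat_poly M p) = dim_row M" "dim_col (mat_poly M p) = dim_row M"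
proof -
  have "dim_row (mat_poly M p) = dim_row M \<and> dim_col (mat_poly M p) = dim_row M"
    by (induct p) (auto simp: mat_poly_def)
  then show "dim_row (mat_poly M p) = dim_row M" "dim_col (mat_poly M p) = dim_row M" by auto
qed

lemma mat_poly_0: "M \<in> carrier_mat N N \<Longrightarrow> mat_poly M 0 = 0\<^sub>m N N"
  by (auto simp: mat_poly_def)

lemma mat_poly_pCons:
  assumes "M \<in> carrier_mat N N"
  shows "mat_poly M (pCons a p) = a \<cdot>\<^sub>m 1\<^sub>m N + M * mat_poly M p"
proof (cases "a = 0 \<and> p = 0")
  case True
  then show ?thesis using assms by (auto simp: mat_poly_0)
next
  case False
  then show ?thesis using assms
    by (auto simp: mat_poly_def)
qed

lemma mat_poly_carrier [simp]:
  assumes "M \<in> carrier_mat N N"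
  shows "mat_poly M p \<in> carrier_mat N N"
  using assms by auto

lemma mat_poly_add:
  assumes M: "M \<in> carrier_mat N N"
  shows "mat_poly M (p + q) = mat_poly M p + mat_poly M q"
proof (induct p q rule: poly_induct2)
  case 0
  show ?case using M by (simp add: mat_poly_0)
next
  case (pCons a p b q)
  have "M * mat_poly M (p + q) = M * mat_poly M p + M * mat_poly M q"
    unfolding pCons by (rule mult_add_distrib_mat[of _ N N _ N]) (use M in auto)
  moreover have "M * mat_poly M p \<in> carrier_mat N N" "M * mat_poly M q \<in> carrier_mat N N"
    using mult_carrier_mat[OF M mat_poly_carrier[OF M]] by blast+
  ultimately show ?case
    using M by (simp add: mat_poly_pCons) (intro eq_matI, auto simp: algebra_simps)
qed

lemma mat_poly_smult:
  assumes M: "M \<in> carrier_mat N N"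
  shows "mat_poly M (smult c p) = c \<cdot>\<^sub>m mat_poly M p"
proof (induct p)
  case 0
  show ?case using M by (auto simp: mat_poly_0)
next
  case (pCons a p)
  have "M * (c \<cdot>\<^sub>m mat_poly M p) = c \<cdot>\<^sub>m (M * mat_poly M p)"
    by (rule mult_smult_distrib[of _ N N _ N]) (use M in auto)
  moreover have "M * mat_poly M p \<in> carrier_mat N N"
    using mult_carrier_mat[OF M mat_poly_carrier[OF M]] by blast
  ultimately show ?case
    using M pCons by (simp add: mat_poly_pCons) (intro eq_matI, auto simp: algebra_simps)
qed

lemma mat_poly_pCons_0:
  assumes M: "M \<in> carrier_mat N N"
  shows "mat_poly M (pCons 0 p) = M * mat_poly M p"
proof -
  have "M * mat_poly M p \<in> carrier_mat N N"
    by (rule mult_carrier_mat[OF M mat_poly_carrier[OF M]])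
  then show ?thesis
    unfolding mat_poly_pCons[OF M] using M mat_poly_carrier[OF M, of p] by (intro eq_matI) auto
qed

lemma mat_poly_mult:
  assumes M: "M \<in> carrier_mat N N"
  shows "mat_poly M (p * q) = mat_poly M p * mat_poly M q"
proof (induct p)
  case 0
  show ?case using M by (simp add: mat_poly_0 left_mult_zero_mat[where nc = N])
next
  case (pCons a p)
  have "mat_poly M (pCons a p * q) = a \<cdot>\<^sub>m mat_poly M q + M * mat_poly M (p * q)"
    using M by (simp add: mat_poly_add mat_poly_smult mat_poly_pCons_0)
  also have "M * mat_poly M (p * q) = M * mat_poly M p * mat_poly M q"
    using M by (simp add: pCons assoc_mult_mat[where n\<^sub>1=N and n\<^sub>2=N and n\<^sub>3=N and n\<^sub>4=N])
  also have "a \<cdot>\<^sub>m mat_poly M q = a \<cdot>\<^sub>m 1\<^sub>m N * mat_poly M q"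
    using M by (simp add: mult_smult_assoc_mat[of _ N N _ N] left_mult_one_mat[of _ N N])
  also have "a \<cdot>\<^sub>m 1\<^sub>m N * mat_poly M q + M * mat_poly M p * mat_poly M q
      = (a \<cdot>\<^sub>m 1\<^sub>m N + M * mat_poly M p) * mat_poly M q"
    by (rule add_mult_distrib_mat[symmetric, of _ N N]) (use M in auto)
  finally show ?case using M by (simp add: mat_poly_pCons)
qed

lemma mat_poly_linear:
  assumes M: "M \<in> carrier_mat N N"
  shows "mat_poly M [:a, 1:] = a \<cdot>\<^sub>m 1\<^sub>m N + M"
  using M by (auto simp: mat_poly_pCons mat_poly_0)

lemma mat_poly_1:
  assumes M: "M \<in> carrier_mat N N"
  shows "mat_poly M 1 = 1\<^sub>m N"
  using M by (auto simp: mat_poly_pCons mat_poly_0 one_pCons)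

lemma det_mat_poly_power:
  assumes M: "M \<in> carrier_mat N N"
  shows "det (mat_poly M (p ^ k)) = det (mat_poly M p) ^ k"
  using M by (induct k) (simp_all add: mat_poly_1 mat_poly_mult det_mult[of _ N])

lemma det_mat_poly_linear_factors:
  assumes M: "M \<in> carrier_mat N N"
  shows "det (mat_poly M (\<Prod>a\<leftarrow>as. [:- a, 1:])) = (\<Prod>a\<leftarrow>as. det (mat_poly M [:- a, 1:]))"
  using M by (induct as)
    (simp_all add: mat_poly_1 mat_poly_mult det_mult[of _ N] del: mult_pCons_left)

lemma smult_mat_mult_vec:
  fixes a :: "'a :: comm_ring_1"
  assumes "M \<in> carrier_mat N K" "v \<in> carrier_vec K"
  shows "(a \<cdot>\<^sub>m M) *\<^sub>v v = a \<cdot>\<^sub>v (M *\<^sub>v v)"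
  using assms by (intro eq_vecI) (auto simp: scalar_prod_def sum_distrib_left mult.assoc)

lemma mat_poly_commute:
  assumes M: "M \<in> carrier_mat N N"
  shows "mat_poly M p * M = M * mat_poly M p"
proof -
  have "mat_poly M [:0, 1:] = M"
    using M by (simp add: mat_poly_linear) (intro eq_matI, auto)
  then show ?thesis
    by (metis M mat_poly_mult mult.commute)
qed

lemma mat_poly_mult_vec_nth:
  assumes M: "M \<in> carrier_mat N N" and v: "v \<in> carrier_vec N" and i: "i < N" and "degree p < K"
  shows "(mat_poly M p *\<^sub>v v) $ i = (\<Sum>k<K. coeff p k * ((M ^\<^sub>m k *\<^sub>v v) $ i))"
  using v \<open>degree p < K\<close>
proof (induct p arbitrary: v K)
  case 0
  then show ?case using M i by (simp add: mat_poly_0)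
next
  case (pCons a p)
  obtain K' where K: "K = Suc K'" using pCons by (cases K) auto
  note p = mat_poly_commute[OF M, of p]
  have Mv: "M *\<^sub>v v \<in> carrier_vec N" using M pCons by auto
  have "mat_poly M (pCons a p) *\<^sub>v v = (a \<cdot>\<^sub>m 1\<^sub>m N + mat_poly M p * M) *\<^sub>v v"
    using M by (simp add: mat_poly_pCons p)
  also have "\<dots> = (a \<cdot>\<^sub>m 1\<^sub>m N) *\<^sub>v v + (mat_poly M p * M) *\<^sub>v v"
    by (rule add_mult_distrib_mat_vec)
      (use M pCons(3) mult_carrier_mat[OF mat_poly_carrier[OF M] M] in auto)
  also have "\<dots> = a \<cdot>\<^sub>v v + mat_poly M p *\<^sub>v (M *\<^sub>v v)"
    using M pCons(3)
    by (simp add: smult_mat_mult_vec[of _ N N] assoc_mult_mat_vec[of _ N N _ N])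
  finally have "mat_poly M (pCons a p) *\<^sub>v v = a \<cdot>\<^sub>v v + mat_poly M p *\<^sub>v (M *\<^sub>v v)" .
  then have 1: "(mat_poly M (pCons a p) *\<^sub>v v) $ i = a * v $ i + (mat_poly M p *\<^sub>v (M *\<^sub>v v)) $ i"
    using i M pCons(3) by (simp del: index_mult_mat_vec)
  have 2: "(mat_poly M p *\<^sub>v (M *\<^sub>v v)) $ i = (\<Sum>k<K'. coeff p k * ((M ^\<^sub>m Suc k *\<^sub>v v) $ i))"
  proof (cases "p = 0")
    case True
    then show ?thesis using M Mv i by (simp add: mat_poly_0)
  next
    case False
    then have "degree p < K'" using pCons K by simp
    from pCons(2)[OF Mv this] show ?thesis
      using M pCons(3) by (simp add: assoc_mult_mat_vec[of _ N N _ N] pow_carrier_mat)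
  qed
  have 3: "M ^\<^sub>m 0 *\<^sub>v v = v"
    using M pCons(3) by simp
  show ?case unfolding 1 2 K sum.lessThan_Suc_shift 3 by simp
qed

lemma mat_poly_add_vec:
  assumes "M \<in> carrier_mat N N" "v \<in> carrier_vec N"
  shows "mat_poly M (p + q) *\<^sub>v v = mat_poly M p *\<^sub>v v + mat_poly M q *\<^sub>v v"
  using assms by (simp add: mat_poly_add add_mult_distrib_mat_vec[of _ N N])

lemma mat_poly_diff_vec:
  assumes M: "M \<in> carrier_mat N N" and v: "v \<in> carrier_vec N"
  shows "mat_poly M (p - q) *\<^sub>v v = mat_poly M p *\<^sub>v v - mat_poly M q *\<^sub>v v"
proof -
  have "mat_poly M p *\<^sub>v v = mat_poly M (p - q) *\<^sub>v v + mat_poly M q *\<^sub>v v"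
    using mat_poly_add_vec[OF assms, of "p - q" q] by simp
  then show ?thesis using M by (intro eq_vecI) (auto simp del: index_mult_mat_vec)
qed

lemma mat_poly_mult_vec:
  assumes "M \<in> carrier_mat N N" "v \<in> carrier_vec N"
  shows "mat_poly M (p * q) *\<^sub>v v = mat_poly M p *\<^sub>v (mat_poly M q *\<^sub>v v)"
  using assms by (simp add: mat_poly_mult assoc_mult_mat_vec[of _ N N _ N])

lemma mat_poly_linear_vec:
  assumes "M \<in> carrier_mat N N" "v \<in> carrier_vec N"
  shows "mat_poly M [:a, 1:] *\<^sub>v v = a \<cdot>\<^sub>v v + M *\<^sub>v v"
  using assms
  by (simp add: mat_poly_linear add_mult_distrib_mat_vec[of _ N N] smult_mat_mult_vec[of _ N N])

text \<open>
  The square matrix of order \<open>N\<close> whose columns are \<open>f 0, \<dots>, f (N - 1)\<close>.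
\<close>

definition mat_cols :: "nat \<Rightarrow> (nat \<Rightarrow> 'a vec) \<Rightarrow> 'a mat" where
  "mat_cols N f = mat N N (\<lambda>(r, c). f c $ r)"

lemma mat_cols_carrier [simp]: "mat_cols N f \<in> carrier_mat N N"
  by (simp add: mat_cols_def)

lemma mult_mat_cols:
  assumes "M \<in> carrier_mat N N" "\<And>c. c < N \<Longrightarrow> f c \<in> carrier_vec N"
  shows "M * mat_cols N f = mat_cols N (\<lambda>c. M *\<^sub>v f c)"
proof -
  have "col (mat_cols N f) c = f c" if "c < N" for c
    using assms(2)[OF that] that by (intro eq_vecI) (auto simp: mat_cols_def)
  then show ?thesis
    using assms(1) carrier_matD[OF mat_cols_carrier[of N f]]
    by (intro eq_matI) (auto simp: mat_cols_def[of N "\<lambda>c. M *\<^sub>v f c"] simp del: mat_cols_carrier)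
qed

lemma mat_cols_cong:
  "(\<And>c. c < N \<Longrightarrow> f c = g c) \<Longrightarrow> mat_cols N f = mat_cols N g"
  by (intro eq_matI) (auto simp: mat_cols_def)

text \<open>
  The walk matrix \<open>[v, M v, \<dots>, M\<^sup>N\<^sup>-\<^sup>1 v]\<close> of a square matrix \<open>M\<close> of order \<open>N\<close>, for an
  arbitrary start vector \<open>v\<close>.
\<close>

definition walk_mat :: "'a :: comm_ring_1 mat \<Rightarrow> 'a vec \<Rightarrow> 'a mat" where
  "walk_mat M v = mat_cols (dim_row M) (\<lambda>k. M ^\<^sub>m k *\<^sub>v v)"

lemma walk_mat_mat_poly:
  assumes M: "M \<in> carrier_mat N N" and v: "v \<in> carrier_vec N"
  shows "walk_mat M (mat_poly M p *\<^sub>v v) = mat_poly M p * walk_mat M v"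
proof -
  have pow: "M ^\<^sub>m k = mat_poly M ([:0, 1:] ^ k)" for k
    using M by (induct k)
      (simp_all add: mat_poly_1 mat_poly_pCons_0 mat_poly_commute)
  have "M ^\<^sub>m k *\<^sub>v (mat_poly M p *\<^sub>v v) = mat_poly M p *\<^sub>v (M ^\<^sub>m k *\<^sub>v v)" for k
    using M v by (simp add: pow assoc_mult_mat_vec[of _ N N _ N, symmetric]
        mat_poly_mult[symmetric] mult.commute)
  moreover have "M ^\<^sub>m k *\<^sub>v v \<in> carrier_vec N" for k
    using M v by (meson mult_mat_vec_carrier pow_carrier_mat)
  ultimately show ?thesis
    using M v by (simp add: walk_mat_def mult_mat_cols)
qed

text \<open>
  Replacing the powers of \<open>M\<close> by other polynomials of degree below \<open>N\<close> is a column operation on the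
  walk matrix, performed by the matrix of coefficients.
\<close>

lemma walk_mat_mult_coeffs:
  assumes M: "M \<in> carrier_mat N N" and v: "v \<in> carrier_vec N"
    and deg: "\<And>c. c < N \<Longrightarrow> degree (p c) < N"
  shows "walk_mat M v * mat N N (\<lambda>(k, c). coeff (p c) k) = mat_cols N (\<lambda>c. mat_poly M (p c) *\<^sub>v v)"
  using M mat_poly_mult_vec_nth[OF M v _ deg]
  by (intro eq_matI) (auto simp: walk_mat_def mat_cols_def scalar_prod_def lessThan_atLeast0 mult.commute)

section \<open>Path polynomials and a unimodular basis\<close>

text \<open>
  Let \<open>P\<close> be the signless Laplacian of a long path with its vertices numbered from a leaf, starting
  at \<open>0\<close>. The polynomial \<open>q\<^sub>k\<close> is the monic one of degree \<open>k\<close> with \<open>q\<^sub>k(P) \<epsilon>\<^sub>0 = \<epsilon>\<^sub>k\<close>: the recursion reads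
  \<open>\<epsilon>\<^sub>k\<^sub>+\<^sub>2 = P \<epsilon>\<^sub>k\<^sub>+\<^sub>1 - 2 \<epsilon>\<^sub>k\<^sub>+\<^sub>1 - \<epsilon>\<^sub>k\<close>, and the leaf has degree \<open>1\<close> instead of \<open>2\<close>.
\<close>

fun path_poly :: "nat \<Rightarrow> 'a :: comm_ring_1 poly" where
  "path_poly 0 = 1"
| "path_poly (Suc 0) = [:- 1, 1:]"
| "path_poly (Suc (Suc k)) = [:- 2, 1:] * path_poly (Suc k) - path_poly k"

lemma degree_monic_path_poly:
  "degree (path_poly k :: 'a :: idom poly) = k \<and> lead_coeff (path_poly k :: 'a poly) = 1"
proof (induct k rule: path_poly.induct)
  case (3 k)
  have q: "path_poly (Suc k) \<noteq> (0 :: 'a poly)" using 3 by auto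
  have d: "degree ([:- 2, 1:] * path_poly (Suc k) :: 'a poly) = Suc (Suc k)"
    using 3 q by (subst degree_mult_eq) auto
  have l: "lead_coeff ([:- 2, 1:] * path_poly (Suc k) :: 'a poly) = 1"
    using 3 by (subst lead_coeff_mult) auto
  have "degree (path_poly (Suc (Suc k)) :: 'a poly) = Suc (Suc k)"
    using 3 d unfolding path_poly.simps diff_conv_add_uminus
    by (subst degree_add_eq_left) (auto simp del: mult_pCons_left)
  moreover have "coeff (path_poly k :: 'a poly) (Suc (Suc k)) = 0"
    using 3 by (intro coeff_eq_0) auto
  ultimately show ?case using d l by simp
qed auto

lemma degree_path_poly [simp]: "degree (path_poly k :: 'a :: idom poly) = k"
  and lead_coeff_path_poly [simp]: "coeff (path_poly k :: 'a :: idom poly) k = 1"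
  using degree_monic_path_poly[of k, where ?'a = 'a] by auto

lemma path_poly_nonzero [simp]: "path_poly k \<noteq> (0 :: 'a :: idom poly)"
  using lead_coeff_path_poly[of k] by (metis coeff_0 zero_neq_one)

lemma of_int_path_poly: "map_poly of_int (path_poly k) = (path_poly k :: 'a :: comm_ring_1 poly)"
proof (induct k rule: path_poly.induct)
  case (3 k)
  then show ?case
    unfolding path_poly.simps of_int_poly_hom.hom_minus of_int_poly_hom.hom_mult by simp
qed simp_all

text \<open>
  Consecutive polynomials generate the unit ideal over every commutative ring, in particular over the
  integers.
\<close>

lemma path_poly_bezout:
  "\<exists>u v. u * path_poly (Suc k) + v * path_poly k = (1 :: 'a :: comm_ring_1 poly)"
proof (induct k)
  case 0
  show ?case by (rule exI[of _ 0], rule exI[of _ 1]) simp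
next
  case (Suc k)
  then obtain u v :: "'a poly" where uv: "u * path_poly (Suc k) + v * path_poly k = 1" by blast
  have "(- v) * path_poly (Suc (Suc k)) + (u + v * [:- 2, 1:]) * path_poly (Suc k)
      = u * path_poly (Suc k) + v * path_poly k"
    by (simp del: mult_pCons_left mult_pCons_right add: algebra_simps)
  then show ?case using uv by metis
qed

text \<open>
  At a fixed \<open>x\<close>, the step from \<open>(q\<^sub>k, q\<^sub>k\<^sub>+\<^sub>1)\<close> to \<open>(q\<^sub>k\<^sub>+\<^sub>1, q\<^sub>k\<^sub>+\<^sub>2)\<close> is a linear map of determinant \<open>1\<close>
  that does not depend on \<open>k\<close>, and it preserves a quadratic form.
\<close>

lemma path_poly_invariant:
  "(poly (path_poly (Suc k)) x)\<^sup>2 - (x - 2) * poly (path_poly (Suc k)) x * poly (path_poly k) x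
     + (poly (path_poly k) x)\<^sup>2 = (x :: 'a :: comm_ring_1)"
proof (induct k)
  case 0
  show ?case by (simp add: power2_eq_square algebra_simps)
next
  case (Suc k)
  define a b where "a = poly (path_poly (Suc k)) x" and "b = poly (path_poly k) x"
  have "poly (path_poly (Suc (Suc k))) x = (x - 2) * a - b"
    by (simp add: a_def b_def algebra_simps)
  moreover have "((x - 2) * a - b)\<^sup>2 - (x - 2) * ((x - 2) * a - b) * a + a\<^sup>2
      = a\<^sup>2 - (x - 2) * a * b + b\<^sup>2"
    by (simp add: power2_eq_square algebra_simps)
  ultimately show ?case
    using Suc by (simp only: a_def b_def)
qed

lemma path_poly_sum:
  "(x - 4) * (\<Sum>k\<le>l. poly (path_poly k) x)
     = poly (path_poly (Suc l)) x - poly (path_poly l) x - (2 :: 'a :: comm_ring_1)"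
proof (induct l)
  case 0
  show ?case by simp
next
  case (Suc l)
  define a b where "a = poly (path_poly (Suc l)) x" and "b = poly (path_poly l) x"
  have c: "poly (path_poly (Suc (Suc l))) x = (x - 2) * a - b"
    by (simp add: a_def b_def algebra_simps)
  have "(x - 4) * (\<Sum>k\<le>Suc l. poly (path_poly k) x) = (a - b - 2) + (x - 4) * a"
    using Suc by (simp add: a_def b_def distrib_left)
  also have "\<dots> = ((x - 2) * a - b) - a - 2"
    by (simp add: algebra_simps)
  finally show ?case unfolding c by (simp only: a_def)
qed

lemma poly_path_poly_4: "poly (path_poly k) (4 :: 'a :: comm_ring_1) = of_nat (2 * k + 1)"
  by (induct k rule: path_poly.induct) (auto simp: algebra_simps)

lemma poly_path_poly_0: "poly (path_poly k) (0 :: 'a :: comm_ring_1) = (- 1) ^ k"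
  by (induct k rule: path_poly.induct) (auto simp: algebra_simps)

text \<open>
  At a root of \<open>q\<^sub>0 + \<dots> + q\<^sub>l\<close> the summation formula gives \<open>q\<^sub>l\<^sub>+\<^sub>1 = q\<^sub>l + 2\<close>, and then the quadratic
  form leaves only \<open>q\<^sub>l = - 1\<close>. This argument does not need the roots to be simple, and in general
  they are not.
\<close>

lemma root_sum_path_poly:
  fixes x :: "'a :: {idom, ring_char_0}"
  assumes "poly (\<Sum>k\<le>l. path_poly k) x = 0"
  shows "poly (path_poly l) x = - 1" and "poly (path_poly (Suc l)) x = 1"
proof -
  define a b where "a = poly (path_poly (Suc l)) x" and "b = poly (path_poly l) x"
  have sum0: "(\<Sum>k\<le>l. poly (path_poly k) x) = 0"
    using assms by (simp add: poly_sum)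
  \<comment> \<open>At \<open>4\<close> the value of the sum is \<open>1 + 3 + \<dots> + (2 l + 1)\<close>, which is not zero.\<close>
  have "x \<noteq> 4"
  proof
    assume "x = 4"
    then have "(of_nat (\<Sum>k\<le>l. 2 * k + 1) :: 'a) = 0"
      using sum0 by (simp add: poly_path_poly_4)
    then have "(\<Sum>k\<le>l. 2 * k + 1) = 0" by (simp only: of_nat_eq_0_iff)
    then have "2 * 0 + 1 = (0 :: nat)" unfolding sum_eq_0_iff[OF finite_atMost] by blast
    then show False by simp
  qed
  moreover have "a - b - 2 = 0"
    using path_poly_sum[of x l] unfolding a_def b_def sum0 by simp
  then have a: "a = b + 2" by (simp only: right_minus_eq diff_diff_eq)
  moreover have "a\<^sup>2 - (x - 2) * a * b + b\<^sup>2 = x"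
    using path_poly_invariant[of l x] by (simp add: a_def b_def)
  then have "(4 - x) * (b + 1)\<^sup>2 = 0"
    unfolding a by (simp add: power2_eq_square algebra_simps)
  ultimately have "b + 1 = 0" by auto
  then show "b = - 1" "a = 1" using a by (auto simp: add_eq_0_iff2)
qed

lemma root_path_poly:
  fixes x :: "'a :: comm_ring_1"
  assumes "poly (path_poly l) x = 0"
  shows "(poly (path_poly (Suc l)) x)\<^sup>2 = x"
  using path_poly_invariant[of l x] assms by simp

lemma degree_lead_coeff_sum_path_poly:
  "degree (\<Sum>k\<le>l. path_poly k :: 'a :: idom poly) = l"
  "coeff (\<Sum>k\<le>l. path_poly k :: 'a :: idom poly) l = 1"
proof -
  show c: "coeff (\<Sum>k\<le>l. path_poly k :: 'a :: idom poly) l = 1"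
  proof -
    have "coeff (\<Sum>k\<le>l. path_poly k :: 'a poly) l = (\<Sum>k\<le>l. if k = l then 1 else 0)"
      unfolding coeff_sum by (rule sum.cong) (auto simp: coeff_eq_0)
    then show ?thesis by simp
  qed
  have "degree (\<Sum>k\<le>l. path_poly k :: 'a poly) \<le> l"
    by (rule degree_sum_le) auto
  moreover have "l \<le> degree (\<Sum>k\<le>l. path_poly k :: 'a poly)"
    by (rule le_degree) (simp add: c)
  ultimately show "degree (\<Sum>k\<le>l. path_poly k :: 'a poly) = l" by simp
qed

lemma path_poly_combination:
  "degree (p :: 'a :: idom poly) \<le> k \<Longrightarrow> \<exists>c. p = (\<Sum>i\<le>k. Polynomial.smult (c i) (path_poly i))"
proof (induct k arbitrary: p)
  case 0
  then obtain a where "p = [:a:]" using degree_eq_zeroE by auto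
  then show ?case by (intro exI[of _ "\<lambda>_. a"]) (simp add: one_pCons)
next
  case (Suc k)
  let ?r = "p - Polynomial.smult (coeff p (Suc k)) (path_poly (Suc k))"
  have "degree ?r \<le> Suc k"
    using Suc.prems by (intro degree_diff_le order.trans[OF degree_smult_le]) auto
  moreover have "coeff ?r (Suc k) = 0" by simp
  ultimately have "degree ?r \<le> k"
    using eq_zero_or_degree_less[of ?r "Suc k"] by (cases "?r = 0") (auto simp del: path_poly.simps)
  from Suc.hyps[OF this] obtain c where c: "?r = (\<Sum>i\<le>k. Polynomial.smult (c i) (path_poly i))" by blast
  let ?c = "c(Suc k := coeff p (Suc k))"
  have "(\<Sum>i\<le>Suc k. Polynomial.smult (?c i) (path_poly i)) = ?r + Polynomial.smult (coeff p (Suc k)) (path_poly (Suc k))"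
    unfolding c by simp
  then show ?case by (intro exI[of _ ?c]) simp
qed

lemma bezout_power:
  fixes a b :: "'a :: comm_ring_1"
  assumes "u * a + v * b = 1"
  shows "\<exists>u v. u * a ^ k + v * b = 1"
proof (induct k)
  case 0
  show ?case by (rule exI[of _ 1], rule exI[of _ 0]) simp
next
  case (Suc k)
  then obtain s t where st: "s * a ^ k + t * b = 1" by blast
  have "1 = s * a ^ k * (u * a + v * b) + t * b" using assms st by simp
  also have "\<dots> = (s * u) * a ^ Suc k + (s * a ^ k * v + t) * b" by (simp add: algebra_simps)
  finally show ?case by metis
qed

lemma monic_division:
  fixes p B :: "int poly"
  assumes "lead_coeff B = 1"
  shows "\<exists>s r. p = s * B + r \<and> (r = 0 \<or> degree r < degree B)"
proof -
  obtain s r where sr: "pseudo_divmod p B = (s, r)" by (cases "pseudo_divmod p B") auto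
  have "B \<noteq> 0" using assms by auto
  from pseudo_divmod[OF this sr] show ?thesis
    using assms by (intro exI[of _ s] exI[of _ r]) (auto simp: mult.commute)
qed

text \<open>
  If monic polynomials \<open>A\<close> of degree \<open>d + 1\<close> and \<open>B\<close> of degree \<open>d\<close> generate the unit ideal of
  \<open>\<int>[s]\<close>, then the products
  \<open>A\<^sup>j B\<^sup>l\<^sup>-\<^sup>j h\<close> with \<open>deg h \<le> d\<close> span all integer polynomials of degree below \<open>(d + 1) (l + 1)\<close>.
\<close>

lemma homogeneous_expansion:
  fixes A B :: "int poly"
  assumes A: "degree A = Suc d" "lead_coeff A = 1" and B: "degree B = d" "lead_coeff B = 1"
    and d: "d > 0" and bezout: "u * A + v * B = 1"
    and "degree p < Suc d * Suc l"
  shows "\<exists>h. (\<forall>j. degree (h j) \<le> d) \<and> p = (\<Sum>j\<le>l. A ^ j * B ^ (l - j) * h j)"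
  using \<open>degree p < Suc d * Suc l\<close>
proof (induct l arbitrary: p)
  case 0
  then show ?case by (intro exI[of _ "\<lambda>_. p"]) auto
next
  case (Suc l)
  define L where "L = Suc l"
  have nz: "A \<noteq> 0" "B \<noteq> 0" using A B by auto
  have degAL: "degree (A ^ L) = Suc d * L"
    using A nz by (simp add: degree_power_eq)
  have lcAL: "coeff (A ^ L) (Suc d * L) = 1"
    using A(2) degAL lead_coeff_power[of A L] by simp
  obtain u' v' where uv': "u' * A ^ L + v' * B = 1"
    using bezout_power[OF bezout] by blast
  \<comment> \<open>The coefficient of \<open>A\<^sup>L\<close> is determined modulo \<open>B\<close>, so it can be taken of degree below \<open>d\<close>.\<close>
  obtain s r where sr: "p * u' = s * B + r" "degree r < d"
    using monic_division[OF B(2), of "p * u'"] B d by fastforce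
  define p0 where "p0 = s * A ^ L + p * v'"
  have p: "p = B * p0 + A ^ L * r"
  proof -
    have "p = p * (u' * A ^ L + v' * B)" using uv' by simp
    also have "\<dots> = (p * u') * A ^ L + p * v' * B" by (simp add: algebra_simps)
    finally show ?thesis unfolding sr(1) p0_def by (simp add: algebra_simps)
  qed
  have "degree (A ^ L * r) < Suc d * Suc L"
    using sr(2) degAL degree_mult_le[of "A ^ L" r] by simp
  then have "degree (B * p0) < Suc d * Suc L"
    using p degree_diff_le_max[of p "A ^ L * r"] Suc.prems unfolding L_def
    by (metis add_diff_cancel_right' le_less_trans max_less_iff_conj)
  then have degp0: "degree p0 \<le> Suc d * L"
    using nz B by (cases "p0 = 0") (auto simp: degree_mult_eq)
  \<comment> \<open>The cofactor \<open>p0\<close> of \<open>B\<close> may have one degree too many; a multiple of \<open>A\<^sup>L\<close> corrects it.\<close>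
  define c where "c = coeff p0 (Suc d * L)"
  define p' where "p' = p0 - Polynomial.smult c (A ^ L)"
  have "degree p' \<le> Suc d * L"
    unfolding p'_def using degp0 degAL by (intro degree_diff_le order.trans[OF degree_smult_le]) auto
  moreover have "coeff p' (Suc d * L) = 0"
    using lcAL by (simp add: p'_def c_def)
  ultimately have "degree p' < Suc d * Suc l"
    unfolding L_def
    using eq_zero_or_degree_less[of p' "Suc d * Suc l"] by (cases "p' = 0") auto
  from Suc.hyps[OF this] obtain h where h: "\<And>j. degree (h j) \<le> d"
    "p' = (\<Sum>j\<le>l. A ^ j * B ^ (l - j) * h j)" by blast
  define h' where "h' = h(L := r + Polynomial.smult c B)"
  have "degree (h' j) \<le> d" for j
    using h sr(2) B by (auto simp: h'_def intro!: degree_add_le order.trans[OF degree_smult_le])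
  moreover have "p = (\<Sum>j\<le>Suc l. A ^ j * B ^ (Suc l - j) * h' j)"
  proof -
    have "(\<Sum>j\<le>l. A ^ j * B ^ (Suc l - j) * h' j) = (\<Sum>j\<le>l. B * (A ^ j * B ^ (l - j) * h j))"
      by (rule sum.cong) (auto simp: h'_def L_def Suc_diff_le)
    also have "\<dots> = B * p'" by (simp add: h(2) sum_distrib_left)
    finally have "(\<Sum>j\<le>Suc l. A ^ j * B ^ (Suc l - j) * h' j) = B * p' + A ^ L * (r + Polynomial.smult c B)"
      by (simp add: h'_def L_def)
    also have "\<dots> = p" unfolding p'_def p by (simp add: algebra_simps)
    finally show ?thesis by simp
  qed
  ultimately show ?case by blast
qed

text \<open>
  An integer matrix whose columns generate the lattice of all integer vectors has an integer right inverse, hence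
  determinant \<open>1\<close> or \<open>- 1\<close>.
\<close>

lemma det_coeff_mat_of_basis:
  fixes \<beta> :: "nat \<Rightarrow> int poly"
  assumes "\<And>k. k < N \<Longrightarrow> \<exists>x. monom 1 k = (\<Sum>c<N. Polynomial.smult (x c) (\<beta> c))"
  shows "\<bar>det (mat N N (\<lambda>(k, c). coeff (\<beta> c) k))\<bar> = 1"
proof -
  have "\<forall>k. \<exists>x. k < N \<longrightarrow> monom 1 k = (\<Sum>c<N. Polynomial.smult (x c) (\<beta> c))"
    using assms by blast
  from choice[OF this] obtain x
    where x: "\<And>k. k < N \<Longrightarrow> monom 1 k = (\<Sum>c<N. Polynomial.smult (x k c) (\<beta> c))"
    by blast
  let ?U = "mat N N (\<lambda>(k, c). coeff (\<beta> c) k)" and ?X = "mat N N (\<lambda>(c, k). x k c)"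
  have "?U * ?X = 1\<^sub>m N"
  proof (rule eq_matI)
    fix i k assume "i < dim_row (1\<^sub>m N :: int mat)" "k < dim_col (1\<^sub>m N :: int mat)"
    then have ik: "i < N" "k < N" by auto
    have "(?U * ?X) $$ (i, k) = (\<Sum>c<N. coeff (Polynomial.smult (x k c) (\<beta> c)) i)"
      using ik by (simp add: scalar_prod_def lessThan_atLeast0 mult.commute)
    also have "\<dots> = coeff (monom 1 k) i"
      unfolding x[OF ik(2)] by (simp add: coeff_sum)
    finally show "(?U * ?X) $$ (i, k) = 1\<^sub>m N $$ (i, k)" using ik by auto
  qed auto
  then have "det ?U * det ?X = 1"
    by (subst det_mult[symmetric, of _ N]) auto
  then show ?thesis unfolding zdvd1_eq[symmetric] by (metis dvd_triv_left)
qed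

lemma sum_div_mod:
  "(\<Sum>c<m * n. f (c div n) (c mod n)) = (\<Sum>i<m. \<Sum>j<(n::nat). f i j :: 'a :: comm_monoid_add)"
proof -
  have "(\<Sum>c<m * n. f (c div n) (c mod n))
      = (\<Sum>i<m. \<Sum>c\<in>{i * n..<i * n + n}. f (c div n) (c mod n))"
    by (rule sum.nat_group[symmetric])
  also have "\<dots> = (\<Sum>i<m. \<Sum>j<n. f i j)"
  proof (rule sum.cong)
    fix i
    have "(\<Sum>c\<in>{i * n..<i * n + n}. f (c div n) (c mod n))
        = (\<Sum>j\<in>{0..<n}. f ((j + i * n) div n) ((j + i * n) mod n))"
      using sum.shift_bounds_nat_ivl[of "\<lambda>c. f (c div n) (c mod n)" 0 "i * n" n]
      by (simp add: add.commute)
    then show "(\<Sum>c\<in>{i * n..<i * n + n}. f (c div n) (c mod n)) = (\<Sum>j<n. f i j)"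
      by (simp add: lessThan_atLeast0)
  qed simp
  finally show ?thesis .
qed

text \<open>
  With \<open>A = q\<^sub>m + q\<^sub>m\<^sub>-\<^sub>1\<close>, which is the characteristic polynomial of the signless Laplacian of \<open>P\<^sub>m\<close>, and
  \<open>B = q\<^sub>m\<^sub>-\<^sub>1\<close>, these are the polynomials \<open>A\<^sup>j B\<^sup>n\<^sup>-\<^sup>1\<^sup>-\<^sup>j q\<^sub>i\<close> for \<open>i < m\<close> and \<open>j < n\<close>. The pair \<open>(i, j)\<close> is encoded
  as the number \<open>c = i n + j\<close>.
\<close>

definition walk_basis :: "nat \<Rightarrow> nat \<Rightarrow> nat \<Rightarrow> 'a :: comm_ring_1 poly" where
  "walk_basis m n c = (path_poly m + path_poly (m - 1)) ^ (c mod n)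
     * path_poly (m - 1) ^ (n - 1 - c mod n) * path_poly (c div n)"

lemma degree_path_poly_add:
  assumes "m > 0"
  shows "degree (path_poly m + path_poly (m - 1) :: 'a :: idom poly) = m"
    and "coeff (path_poly m + path_poly (m - 1) :: 'a :: idom poly) m = 1"
  using assms by (auto simp: degree_add_eq_left coeff_eq_0)

lemma degree_walk_basis:
  assumes "m > 0" "c < m * n"
  shows "degree (walk_basis m n c :: 'a :: idom poly) < m * n"
proof -
  have n: "n > 0" using assms by (cases n) auto
  define i j where "i = c div n" and "j = c mod n"
  have i: "i < m" using assms by (simp add: i_def less_mult_imp_div_less)
  have j: "j < n" using n by (simp add: j_def)
  let ?A = "path_poly m + path_poly (m - 1) :: 'a poly"
  note A = degree_path_poly_add[OF assms(1), where ?'a = 'a]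
  have nz: "?A \<noteq> 0" using A by (metis coeff_0 zero_neq_one)
  have "degree (?A ^ j) = m * j"
    using degree_power_eq[OF nz, of j] by (simp only: A(1) mult.commute)
  moreover have "degree (path_poly (m - 1) ^ (n - 1 - j) :: 'a poly) = (m - 1) * (n - 1 - j)"
    using degree_power_eq[OF path_poly_nonzero, of "m - 1" "n - 1 - j", where ?'a = 'a]
    by (simp only: degree_path_poly mult.commute)
  moreover have "degree (walk_basis m n c :: 'a poly)
      = degree (?A ^ j) + degree (path_poly (m - 1) ^ (n - 1 - j) :: 'a poly) + i"
    unfolding walk_basis_def i_def[symmetric] j_def[symmetric]
    using nz by (subst degree_mult_eq; simp)+
  ultimately have "degree (walk_basis m n c :: 'a poly) = m * j + (m - 1) * (n - 1 - j) + i"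
    by simp
  also have "\<dots> \<le> m * j + m * (n - 1 - j) + i" by simp
  also have "\<dots> = m * (n - 1) + i" using j by (simp add: add_mult_distrib2[symmetric])
  also have "\<dots> < m * n" using i n by (cases n) auto
  finally show ?thesis .
qed

text \<open>
  Passing from the monomials of degree below \<open>m n\<close> to this basis is unimodular over the integers.
\<close>

lemma det_walk_basis:
  assumes m: "m \<ge> 2"
  shows "\<bar>det (mat (m * n) (m * n) (\<lambda>(k, c). coeff (walk_basis m n c :: int poly) k))\<bar> = 1"
proof (rule det_coeff_mat_of_basis)
  fix k assume k: "k < m * n"
  let ?A = "path_poly m + path_poly (m - 1) :: int poly" and ?B = "path_poly (m - 1) :: int poly"
  define d where "d = m - 1"
  have md: "m = Suc d" using m by (simp add: d_def)
  obtain l where n: "n = Suc l" using k by (cases n) auto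
  obtain u v :: "int poly" where uv: "u * path_poly (Suc d) + v * path_poly d = 1"
    using path_poly_bezout by blast
  have bez: "u * ?A + (v - u) * ?B = 1"
    using uv by (simp add: md algebra_simps)
  have "degree (monom 1 k :: int poly) < Suc d * Suc l"
    using k by (simp add: degree_monom_eq md n)
  then obtain h where h: "\<And>j. degree (h j) \<le> d"
    "monom 1 k = (\<Sum>j\<le>l. ?A ^ j * ?B ^ (l - j) * h j)"
    using homogeneous_expansion[of ?A d ?B u "v - u" "monom 1 k" l] degree_path_poly_add[of m, where ?'a=int] bez m
    by (auto simp: md)
  have "\<exists>c. \<forall>j. h j = (\<Sum>i\<le>d. Polynomial.smult (c j i) (path_poly i))"
    using path_poly_combination[OF h(1)] by metis
  then obtain c where c: "\<And>j. h j = (\<Sum>i\<le>d. Polynomial.smult (c j i) (path_poly i))" by blast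
  let ?x = "\<lambda>e. c (e mod n) (e div n)"
  have "monom 1 k = (\<Sum>j<n. \<Sum>i<m. Polynomial.smult (c j i) (?A ^ j * ?B ^ (n - 1 - j) * path_poly i))"
    unfolding h(2) c by (simp add: n md lessThan_Suc_atMost sum_distrib_left)
  also have "\<dots> = (\<Sum>i<m. \<Sum>j<n. Polynomial.smult (c j i) (?A ^ j * ?B ^ (n - 1 - j) * path_poly i))"
    by (rule sum.swap)
  also have "\<dots> = (\<Sum>e<m * n. Polynomial.smult (?x e) (walk_basis m n e))"
    unfolding walk_basis_def by (rule sum_div_mod[symmetric])
  finally show "\<exists>x. monom 1 k = (\<Sum>e<m * n. Polynomial.smult (x e) (walk_basis m n e :: int poly))"
    by (rule exI[of _ ?x])
qed

section \<open>Action of the block matrix of a rooted product\<close>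

text \<open>
  Vectors of length \<open>m n\<close> are read as \<open>m\<close> blocks of length \<open>n\<close>; this one is the Kronecker product
  of \<open>z\<close> (of length \<open>m\<close>, given as a function) and \<open>y\<close>: its block \<open>b\<close> is \<open>z b \<cdot> y\<close>.
\<close>

definition tensor_vec :: "nat \<Rightarrow> nat \<Rightarrow> (nat \<Rightarrow> 'a) \<Rightarrow> 'a :: comm_ring_1 vec \<Rightarrow> 'a vec" where
  "tensor_vec m n z y = vec (m * n) (\<lambda>r. z (r div n) * y $ (r mod n))"

text \<open>
  The vector with \<open>y\<close> in block \<open>k\<close> and zeros elsewhere.
\<close>

definition block_vec :: "nat \<Rightarrow> nat \<Rightarrow> nat \<Rightarrow> 'a :: comm_ring_1 vec \<Rightarrow> 'a vec" where
  "block_vec m n k = tensor_vec m n (\<lambda>b. if b = k then 1 else 0)"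

text \<open>
  The entries of the signless Laplacian of a path on \<open>m \<ge> 2\<close> vertices numbered \<open>0, \<dots>, m - 1\<close>.
\<close>

definition path_coeff :: "nat \<Rightarrow> nat \<Rightarrow> nat \<Rightarrow> 'a :: comm_ring_1" where
  "path_coeff m a b =
     (if a = b then (if a = 0 \<or> a = m - 1 then 1 else 2)
      else if a = Suc b \<or> b = Suc a then 1 else 0)"

text \<open>
  The signless Laplacian of the rooted product in block form: block \<open>b\<close> holds the vertices at
  distance \<open>b\<close> from the leaf of their path, so the root block \<open>m - 1\<close> carries the additional summand
  \<open>Q\<close>. Any matrix \<open>Q\<close> of order \<open>n\<close> may take the place of \<open>Q(G)\<close>.
\<close>

definition rooted_mat :: "nat \<Rightarrow> nat \<Rightarrow> 'a :: comm_ring_1 mat \<Rightarrow> 'a mat" where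
  "rooted_mat m n Q = mat (m * n) (m * n) (\<lambda>(r, c).
     (if r div n = c div n \<and> r div n = m - 1 then Q $$ (r mod n, c mod n) else 0)
     + (if r mod n = c mod n then path_coeff m (r div n) (c div n) else 0))"

lemma tensor_vec_carrier [simp]: "tensor_vec m n z y \<in> carrier_vec (m * n)"
  and block_vec_carrier [simp]: "block_vec m n k y \<in> carrier_vec (m * n)"
  by (auto simp: tensor_vec_def block_vec_def)

lemma rooted_mat_carrier [simp]: "rooted_mat m n Q \<in> carrier_mat (m * n) (m * n)"
  by (auto simp: rooted_mat_def)

lemma tensor_vec_dim [simp]: "dim_vec (tensor_vec m n z y) = m * n"
  and block_vec_dim [simp]: "dim_vec (block_vec m n k y) = m * n"
  and rooted_mat_dim [simp]: "dim_row (rooted_mat m n Q) = m * n" "dim_col (rooted_mat m n Q) = m * n"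
  by (auto simp: tensor_vec_def block_vec_def rooted_mat_def)

lemma block_vec_nth:
  "r < m * n \<Longrightarrow> block_vec m n k y $ r = (if r div n = k then y $ (r mod n) else 0)"
  by (auto simp: block_vec_def tensor_vec_def)

lemma div_mod_less:
  assumes "r < m * (n :: nat)"
  shows "r div n < m" "r mod n < n"
  using assms by (auto simp: less_mult_imp_div_less intro!: mod_less_divisor gr0I)

lemma sum_path_coeff:
  fixes z :: "nat \<Rightarrow> 'a :: comm_ring_1"
  assumes m: "m \<ge> 2" and a: "a < m"
  shows "(\<Sum>b<m. path_coeff m a b * z b) =
    (if a = 0 then z 0 + z 1 else if a = m - 1 then z (m - 2) + z (m - 1)
     else z (a - 1) + 2 * z a + z (a + 1))"
proof -
  have "(\<Sum>b<m. path_coeff m a b * z b)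
      = (\<Sum>b<m. (if b = a then (if a = 0 \<or> a = m - 1 then 1 else 2) * z a else 0)
        + (if b = a - 1 then (if a = 0 then 0 else z (a - 1)) else 0)
        + (if b = Suc a then z (Suc a) else 0))"
    by (rule sum.cong) (auto simp: path_coeff_def)
  also have "\<dots> = (if a = 0 \<or> a = m - 1 then 1 else 2) * z a
      + (if a = 0 then 0 else z (a - 1)) + (if Suc a < m then z (Suc a) else 0)"
    using a by (simp add: sum.distrib) 
  finally have sum: "(\<Sum>b<m. path_coeff m a b * z b) = (if a = 0 \<or> a = m - 1 then 1 else 2) * z a
      + (if a = 0 then 0 else z (a - 1)) + (if Suc a < m then z (Suc a) else 0)" .
  obtain k where k: "m = Suc (Suc k)"
    using le_Suc_ex[OF m] by auto
  show ?thesis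
    unfolding sum using a k by auto
qed

lemma rooted_mat_tensor_vec:
  assumes m: "m \<ge> 2" and Q: "Q \<in> carrier_mat n n" and y: "y \<in> carrier_vec n" and r: "r < m * n"
  shows "(rooted_mat m n Q *\<^sub>v tensor_vec m n z y) $ r =
     (if r div n = m - 1 then z (r div n) * (Q *\<^sub>v y) $ (r mod n) else 0)
     + (if r div n = 0 then z 0 + z 1
        else if r div n = m - 1 then z (m - 2) + z (m - 1)
        else z (r div n - 1) + 2 * z (r div n) + z (r div n + 1)) * y $ (r mod n)"
proof -
  define a i where "a = r div n" and "i = r mod n"
  have ai: "a < m" "i < n" using div_mod_less[OF r] by (auto simp: a_def i_def)
  let ?f = "\<lambda>b j. ((if a = b \<and> a = m - 1 then Q $$ (i, j) else 0)
     + (if i = j then path_coeff m a b else 0)) * (z b * y $ j)"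
  have "(rooted_mat m n Q *\<^sub>v tensor_vec m n z y) $ r = (\<Sum>c<m * n. ?f (c div n) (c mod n))"
    unfolding a_def i_def
    using r by (simp add: rooted_mat_def tensor_vec_def scalar_prod_def lessThan_atLeast0)
  also have "\<dots> = (\<Sum>b<m. \<Sum>j<n. ?f b j)" by (rule sum_div_mod)
  also have "\<dots> = (\<Sum>b<m. (if a = b then (if a = m - 1 then z a * (Q *\<^sub>v y) $ i else 0) else 0)
      + path_coeff m a b * z b * y $ i)"
  proof (rule sum.cong)
    fix b
    have "(\<Sum>j<n. ?f b j) = (\<Sum>j<n. (if a = b \<and> a = m - 1 then z b * (Q $$ (i, j) * y $ j) else 0)
      + (if i = j then path_coeff m a b * z b * y $ j else 0))"
      by (rule sum.cong) (auto simp: algebra_simps)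
    also have "\<dots> = (\<Sum>j<n. if a = b \<and> a = m - 1 then z b * (Q $$ (i, j) * y $ j) else 0)
      + path_coeff m a b * z b * y $ i"
      using ai by (simp add: sum.distrib)
    also have "(\<Sum>j<n. if a = b \<and> a = m - 1 then z b * (Q $$ (i, j) * y $ j) else 0)
      = (if a = b \<and> a = m - 1 then z b * (\<Sum>j<n. Q $$ (i, j) * y $ j) else 0)"
    proof (cases "a = b \<and> a = m - 1")
      case True
      then show ?thesis by (simp add: sum_distrib_left)
    next
      case False
      show ?thesis by (simp only: False if_False sum.neutral_const)
    qed
    also have "(\<Sum>j<n. Q $$ (i, j) * y $ j) = (Q *\<^sub>v y) $ i"
      using Q y ai by (simp add: scalar_prod_def lessThan_atLeast0)
    finally show "(\<Sum>j<n. ?f b j)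
      = (if a = b then (if a = m - 1 then z a * (Q *\<^sub>v y) $ i else 0) else 0)
        + path_coeff m a b * z b * y $ i" by auto
  qed simp
  also have "\<dots> = (if a = m - 1 then z a * (Q *\<^sub>v y) $ i else 0)
      + (\<Sum>b<m. path_coeff m a b * z b) * y $ i"
    using ai by (simp add: sum.distrib sum_distrib_right)
  finally show ?thesis
    using ai by (simp only: sum_path_coeff[OF m] a_def i_def)
qed

lemma rooted_mat_path_poly:
  assumes Q: "Q \<in> carrier_mat n n" and y: "y \<in> carrier_vec n" and m: "m \<ge> 2" and "k < m"
  shows "mat_poly (rooted_mat m n Q) (path_poly k) *\<^sub>v block_vec m n 0 y = block_vec m n k y"
  using \<open>k < m\<close>
proof (induct k rule: path_poly.induct)
  case 1
  show ?case by (simp add: mat_poly_1[OF rooted_mat_carrier])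
next
  case 2
  show ?case
    unfolding path_poly.simps mat_poly_linear_vec[OF rooted_mat_carrier block_vec_carrier]
  proof (rule eq_vecI)
    fix r assume "r < dim_vec (block_vec m n (Suc 0) y)"
    then have r: "r < m * n" by simp
    have "(rooted_mat m n Q *\<^sub>v block_vec m n 0 y) $ r
        = (if r div n \<le> 1 then y $ (r mod n) else 0)"
      using m r div_mod_less[OF r]
      unfolding block_vec_def by (subst rooted_mat_tensor_vec[OF m Q y r]) (auto)
    then show "(- 1 \<cdot>\<^sub>v block_vec m n 0 y + rooted_mat m n Q *\<^sub>v block_vec m n 0 y) $ r
        = block_vec m n (Suc 0) y $ r"
      using r
      by (simp add: block_vec_nth del: index_mult_mat_vec)
  qed simp_all
next
  case (3 k)
  then have IH: "mat_poly (rooted_mat m n Q) (path_poly (Suc k)) *\<^sub>v block_vec m n 0 y = block_vec m n (Suc k) y"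
    "mat_poly (rooted_mat m n Q) (path_poly k) *\<^sub>v block_vec m n 0 y = block_vec m n k y" by auto
  show ?case
    unfolding path_poly.simps mat_poly_linear_vec[OF rooted_mat_carrier block_vec_carrier]
      mat_poly_diff_vec[OF rooted_mat_carrier block_vec_carrier]
      mat_poly_mult_vec[OF rooted_mat_carrier block_vec_carrier] IH
  proof (rule eq_vecI)
    fix r assume "r < dim_vec (block_vec m n (Suc (Suc k)) y)"
    then have r: "r < m * n" by simp
    have "(rooted_mat m n Q *\<^sub>v block_vec m n (Suc k) y) $ r
        = (if r div n = k \<or> r div n = Suc (Suc k) then y $ (r mod n)
           else if r div n = Suc k then 2 * y $ (r mod n) else 0)"
    proof -
      define a where "a = r div n"
      have a: "a < m" using div_mod_less[OF r] by (simp add: a_def)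
      obtain l where l: "m = Suc (Suc (Suc k) + l)"
        using less_imp_Suc_add[OF 3(3)] by blast
      consider "a = 0" | "a = m - 1" "a \<noteq> 0" | b where "a = Suc b" "a \<noteq> m - 1"
        using not0_implies_Suc by blast
      then show ?thesis
        unfolding block_vec_def rooted_mat_tensor_vec[OF m Q y r] a_def[symmetric]
        by cases (simp_all add: l)
    qed
    then show "(- 2 \<cdot>\<^sub>v block_vec m n (Suc k) y + rooted_mat m n Q *\<^sub>v block_vec m n (Suc k) y
          - block_vec m n k y) $ r = block_vec m n (Suc (Suc k)) y $ r"
      using r
      by (simp add: block_vec_nth del: index_mult_mat_vec)
  qed simp_all
qed

text \<open>
  With \<open>A\<close> and \<open>B\<close> as above, \<open>A(T)\<close> acts on the leaf block as \<open>Q\<close> followed by \<open>B(T)\<close>. Only in the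
  root block does \<open>Q\<close> enter, and \<open>B(T) = q\<^sub>m\<^sub>-\<^sub>1(T)\<close> moves the leaf block there.
\<close>

lemma rooted_mat_root_relation:
  fixes Q :: "'a :: comm_ring_1 mat"
  assumes Q: "Q \<in> carrier_mat n n" and y: "y \<in> carrier_vec n" and m: "m \<ge> 2"
  shows "mat_poly (rooted_mat m n Q) (path_poly m + path_poly (m - 1) :: 'a poly) *\<^sub>v block_vec m n 0 y
     = mat_poly (rooted_mat m n Q) (path_poly (m - 1)) *\<^sub>v block_vec m n 0 (Q *\<^sub>v y)"
proof -
  obtain k where mk: "m = Suc (Suc k)"
    using le_Suc_ex[OF m] by auto
  have m1: "m - 1 = Suc k"
    and pm: "path_poly m = [:- 2, 1:] * path_poly (Suc k) - (path_poly k :: 'a poly)"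
    by (simp_all only: mk path_poly.simps diff_Suc_1)
  have Qy: "Q *\<^sub>v y \<in> carrier_vec n" using Q y by auto
  have IH: "mat_poly (rooted_mat m n Q) (path_poly (Suc k)) *\<^sub>v block_vec m n 0 y = block_vec m n (Suc k) y"
    "mat_poly (rooted_mat m n Q) (path_poly k) *\<^sub>v block_vec m n 0 y = block_vec m n k y"
    using rooted_mat_path_poly[OF Q y m] mk by auto
  have "mat_poly (rooted_mat m n Q) (path_poly m + path_poly (m - 1)) *\<^sub>v block_vec m n 0 y
     = (- 2 \<cdot>\<^sub>v block_vec m n (Suc k) y + rooted_mat m n Q *\<^sub>v block_vec m n (Suc k) y
          - block_vec m n k y) + block_vec m n (Suc k) y"
    unfolding pm m1 mat_poly_add_vec[OF rooted_mat_carrier block_vec_carrier]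
      mat_poly_linear_vec[OF rooted_mat_carrier block_vec_carrier]
      mat_poly_diff_vec[OF rooted_mat_carrier block_vec_carrier]
      mat_poly_mult_vec[OF rooted_mat_carrier block_vec_carrier] IH by (rule refl)
  also have "\<dots> = block_vec m n (Suc k) (Q *\<^sub>v y)"
  proof (rule eq_vecI)
    fix r assume "r < dim_vec (block_vec m n (Suc k) (Q *\<^sub>v y))"
    then have r: "r < m * n" by simp
    have "(rooted_mat m n Q *\<^sub>v block_vec m n (Suc k) y) $ r
        = (if r div n = k then y $ (r mod n) 
           else if r div n = Suc k then (Q *\<^sub>v y) $ (r mod n) + y $ (r mod n) else 0)"
      using m r div_mod_less[OF r] mk
      unfolding block_vec_def
      by (subst rooted_mat_tensor_vec[OF m Q y r]) (auto simp del: index_mult_mat_vec)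
    then show "((- 2 \<cdot>\<^sub>v block_vec m n (Suc k) y + rooted_mat m n Q *\<^sub>v block_vec m n (Suc k) y
          - block_vec m n k y) + block_vec m n (Suc k) y) $ r = block_vec m n (Suc k) (Q *\<^sub>v y) $ r"
      using r
      by (simp add: block_vec_nth del: index_mult_mat_vec)
  qed simp_all
  also have "\<dots> = mat_poly (rooted_mat m n Q) (path_poly (m - 1)) *\<^sub>v block_vec m n 0 (Q *\<^sub>v y)"
    using rooted_mat_path_poly[OF Q Qy m, of "Suc k"] unfolding m1 by (simp only: mk lessI)
  finally show ?thesis .
qed

lemma rooted_mat_sum_path_poly:
  assumes Q: "Q \<in> carrier_mat n n" and y: "y \<in> carrier_vec n" and m: "m \<ge> 2"
  shows "mat_poly (rooted_mat m n Q) (\<Sum>k\<le>m - 1. path_poly k) *\<^sub>v block_vec m n 0 y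
     = tensor_vec m n (\<lambda>_. 1) y"
proof -
  let ?T = "rooted_mat m n Q"
  have partial: "(mat_poly ?T (\<Sum>k\<le>l. path_poly k) *\<^sub>v block_vec m n 0 y) $ r
      = (if r div n \<le> l then y $ (r mod n) else 0)" if "l < m" and r: "r < m * n" for l r
    using \<open>l < m\<close>
  proof (induct l)
    case 0
    then show ?case using r by (simp add: mat_poly_1[OF rooted_mat_carrier] block_vec_nth)
  next
    case (Suc l)
    then show ?case
      using r
      unfolding sum.atMost_Suc mat_poly_add_vec[OF rooted_mat_carrier block_vec_carrier]
        rooted_mat_path_poly[OF Q y m Suc.prems]
      by (auto simp: block_vec_nth simp del: index_mult_mat_vec)
  qed
  show ?thesis
  proof (rule eq_vecI)
    fix r assume "r < dim_vec (tensor_vec m n (\<lambda>_. 1) y)"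
    then have r: "r < m * n" by (simp add: tensor_vec_def)
    have "r div n \<le> m - 1" using div_mod_less[OF r] by auto
    then show "(mat_poly ?T (\<Sum>k\<le>m - 1. path_poly k) *\<^sub>v block_vec m n 0 y) $ r
        = tensor_vec m n (\<lambda>_. 1) y $ r"
      using partial[OF _ r, of "m - 1"] m r by (simp add: tensor_vec_def)
  qed (simp add: tensor_vec_def rooted_mat_def)
qed

lemma det_block_diagonal:
  fixes w :: "nat \<Rightarrow> 'a :: idom vec"
  shows "det (mat (m * n) (m * n) (\<lambda>(r, c). if r div n = c div n then w (c mod n) $ (r mod n) else 0))
     = det (mat_cols n w) ^ m"
proof (induct m)
  case 0
  show ?case by simp
next
  case (Suc m)
  let ?D = "\<lambda>m. mat (m * n) (m * n) (\<lambda>(r, c). if r div n = c div n then w (c mod n) $ (r mod n) else 0)"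
  have "?D (Suc m) = four_block_mat (?D m) (0\<^sub>m (m * n) n) (0\<^sub>m n (m * n)) (mat_cols n w)"
  proof (rule eq_matI)
    fix r c
    assume "r < dim_row (four_block_mat (?D m) (0\<^sub>m (m * n) n) (0\<^sub>m n (m * n)) (mat_cols n w))"
      and "c < dim_col (four_block_mat (?D m) (0\<^sub>m (m * n) n) (0\<^sub>m n (m * n)) (mat_cols n w))"
    then have rc: "r < m * n + n" "c < m * n + n" by (auto simp: mat_cols_def)
    have last: "x div n = m \<and> x mod n = x - m * n" if "x < m * n + n" "\<not> x < m * n" for x
    proof -
      obtain t where "x = m * n + t" using \<open>\<not> x < m * n\<close> le_Suc_ex not_less by blast
      then show ?thesis using that by auto
    qed
    show "?D (Suc m) $$ (r, c)
        = four_block_mat (?D m) (0\<^sub>m (m * n) n) (0\<^sub>m n (m * n)) (mat_cols n w) $$ (r, c)"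
    proof -
      have ne: "x div n \<noteq> m" if "x < m * n" for x
        using div_mod_less(1)[OF that] by simp
      show ?thesis
        using rc last[OF rc(1)] last[OF rc(2)] ne[of r] ne[of c]
        by (cases "r < m * n"; cases "c < m * n") (simp_all add: mat_cols_def eq_commute[of m])
    qed
  qed (auto simp: mat_cols_def)
  then show ?case
    using Suc by (simp add: det_four_block_mat_lower_left_zero[of _ "m * n" _ n] del: mult_Suc)
qed

section \<open>Determinant of the shifted block matrix\<close>

text \<open>
  Equality up to sign, which is multiplicative and lets the signs of block permutations be ignored.
\<close>

definition eq_up_to_sign :: "'a :: comm_ring_1 \<Rightarrow> 'a \<Rightarrow> bool" where
  "eq_up_to_sign x y \<longleftrightarrow> x = y \<or> x = - y"

lemma eq_up_to_sign_mult:
  "eq_up_to_sign a b \<Longrightarrow> eq_up_to_sign c d \<Longrightarrow> eq_up_to_sign (a * c) (b * d)"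
  by (auto simp: eq_up_to_sign_def)

lemma eq_up_to_sign_power: "eq_up_to_sign a b \<Longrightarrow> eq_up_to_sign (a ^ k) (b ^ k)"
  by (induct k) (auto intro: eq_up_to_sign_mult, simp add: eq_up_to_sign_def)

lemma eq_up_to_sign_prod_list:
  "(\<And>a. a \<in> set as \<Longrightarrow> eq_up_to_sign (f a) (g a))
    \<Longrightarrow> eq_up_to_sign (\<Prod>a\<leftarrow>as. f a) (\<Prod>a\<leftarrow>as. g a)"
  by (induct as) (auto intro: eq_up_to_sign_mult, simp add: eq_up_to_sign_def)

lemma eq_up_to_sign_trans:
  "eq_up_to_sign a b \<Longrightarrow> eq_up_to_sign b c \<Longrightarrow> eq_up_to_sign a c"
  by (auto simp: eq_up_to_sign_def)

lemma eq_up_to_sign_neg_power: "eq_up_to_sign ((- 1) ^ k * x) x"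
  by (cases "even k") (auto simp: eq_up_to_sign_def)

lemma det_lower_unitriangular:
  fixes M :: "'a :: comm_ring_1 mat"
  assumes M: "M \<in> carrier_mat N N"
    and "\<And>i j. i < j \<Longrightarrow> j < N \<Longrightarrow> M $$ (i, j) = 0" and "\<And>i. i < N \<Longrightarrow> M $$ (i, i) = 1"
  shows "det M = 1"
proof -
  have "det M = prod_list (diag_mat M)"
    by (rule det_lower_triangular[OF assms(2) M])
  also have "diag_mat M = map (\<lambda>_. 1) [0..<N]"
    using M assms(3) by (auto simp: diag_mat_def)
  also have "prod_list (map (\<lambda>_. 1 :: 'a) [0..<N]) = 1"
    by (induct N) auto
  finally show ?thesis .
qed

lemma rooted_mat_shift_tensor_vec:
  assumes m: "m \<ge> 2" and Q: "Q \<in> carrier_mat n n" and y: "y \<in> carrier_vec n" and r: "r < m * n"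
  shows "(mat_poly (rooted_mat m n Q) [:- c, 1:] *\<^sub>v tensor_vec m n z y) $ r =
     (if r div n = m - 1 then z (r div n) * (Q *\<^sub>v y) $ (r mod n) else 0)
     + ((if r div n = 0 then z 0 + z 1
        else if r div n = m - 1 then z (m - 2) + z (m - 1)
        else z (r div n - 1) + 2 * z (r div n) + z (r div n + 1)) - c * z (r div n)) * y $ (r mod n)"
proof -
  have "dim_vec (rooted_mat m n Q *\<^sub>v tensor_vec m n z y) = m * n" by simp
  then have "(mat_poly (rooted_mat m n Q) [:- c, 1:] *\<^sub>v tensor_vec m n z y) $ r
      = - c * tensor_vec m n z y $ r + (rooted_mat m n Q *\<^sub>v tensor_vec m n z y) $ r"
    unfolding mat_poly_linear_vec[OF rooted_mat_carrier tensor_vec_carrier]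
    using r by (simp del: index_mult_mat_vec)
  then show ?thesis
    unfolding rooted_mat_tensor_vec[OF m Q y r] using r by (simp add: tensor_vec_def algebra_simps)
qed

text \<open>
  Block elimination: \<open>det (T - c) = \<plusminus> det (B(c) Q - A(c))\<close>. The block column \<open>Z = (q\<^sub>0(c), \<dots>, q\<^sub>m\<^sub>-\<^sub>1(c))\<close>
  solves the homogeneous equations of \<open>T - c\<close> in all blocks but the last. Replacing the first block of the
  identity by \<open>Z\<close> gives a unitriangular \<open>R\<close>, and the product \<open>(T - c) R\<close> with its first block column
  moved to the end is block lower triangular.
\<close>

lemma det_rooted_mat_shift:
  fixes Q :: "'a :: idom mat"
  assumes m: "m \<ge> 2" and Q: "Q \<in> carrier_mat n n"
  shows "eq_up_to_sign (det (mat_poly (rooted_mat m n Q) [:- c, 1:]))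
    (det (poly (path_poly (m - 1)) c \<cdot>\<^sub>m Q - poly (path_poly m + path_poly (m - 1)) c \<cdot>\<^sub>m 1\<^sub>m n))"
proof -
  define N d where "N = m * n" and "d = (m - 1) * n"
  define M where "M = mat_poly (rooted_mat m n Q) [:- c, 1:]"
  define z :: "nat \<Rightarrow> 'a" where "z k = poly (path_poly k) c" for k
  define F where "F = (\<lambda>j. if j < n then tensor_vec m n z (unit_vec n j)
    else block_vec m n (j div n) (unit_vec n (j mod n)))"
  define R where "R = mat_cols N F"
  have N: "N = d + n" using m by (cases m) (auto simp: N_def d_def)
  have M: "M \<in> carrier_mat N N" unfolding M_def N_def by (rule mat_poly_carrier[OF rooted_mat_carrier])
  have F: "F j \<in> carrier_vec N" for j by (simp add: F_def N_def)
  have z0: "z 0 = 1" "z 1 = c - 1" by (simp_all add: z_def)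
  have zSS: "z (Suc (Suc k)) = (c - 2) * z (Suc k) - z k" for k
    by (simp add: z_def algebra_simps)
  have Am: "poly (path_poly m + path_poly (m - 1)) c = (c - 1) * z (m - 1) - z (m - 2)"
  proof -
    obtain k where "m = Suc (Suc k)" using le_Suc_ex[OF m] by auto
    then show ?thesis using zSS[of k] by (simp add: z_def algebra_simps)
  qed
  have detR: "det R = 1"
  proof (rule det_lower_unitriangular[where N = N])
    show "R \<in> carrier_mat N N" by (simp add: R_def)
  next
    fix i j assume ij: "i < j" "j < N"
    have "i div n \<noteq> j div n \<or> i mod n \<noteq> j mod n"
      using ij by (metis div_mult_mod_eq less_irrefl)
    then show "R $$ (i, j) = 0"
      using ij div_mod_less[of i m n] div_mod_less[of j m n]
      by (auto simp: R_def mat_cols_def F_def N_def block_vec_nth tensor_vec_def)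
  next
    fix i assume i: "i < N"
    then show "R $$ (i, i) = 1"
      using div_mod_less[of i m n] z0
      by (auto simp: R_def mat_cols_def F_def N_def block_vec_nth tensor_vec_def)
  qed
  define S where "S = M * R"
  have S: "S \<in> carrier_mat N N" unfolding S_def R_def using M by auto
  have Snth: "S $$ (i, j) = (M *\<^sub>v F j) $ i" if "i < N" "j < N" for i j
    unfolding S_def R_def mult_mat_cols[OF M F] using that by (simp add: mat_cols_def)
  have unit: "(Q *\<^sub>v unit_vec n j) $ i = Q $$ (i, j)" if "i < n" "j < n" for i j
    using that Q by (simp add: scalar_prod_right_unit)
  define S' where "S' = mat N N (\<lambda>(i, j). S $$ (i, if j < d then j + n else if j < n + d then j - d else j))"
  have "det M = det S" using M detR by (simp add: S_def R_def det_mult[of _ N])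
  also have "\<dots> = (- 1) ^ (n * d) * det S'"
    unfolding S'_def by (rule det_swap_initial_cols[OF S]) (simp add: N)
  finally have detM: "eq_up_to_sign (det M) (det S')"
    using eq_up_to_sign_neg_power by metis
  define L where "L = mat d d (\<lambda>(i, j). S' $$ (i, j))"
  define X where "X = mat n d (\<lambda>(i, j). S' $$ (i + d, j))"
  define D where "D = z (m - 1) \<cdot>\<^sub>m Q - ((c - 1) * z (m - 1) - z (m - 2)) \<cdot>\<^sub>m 1\<^sub>m n"
  have D: "D \<in> carrier_mat n n" unfolding D_def by (rule minus_carrier_mat) simp
  have last_block: "i div n = m - 1 \<and> i mod n = i - d" if "i < N" "\<not> i < d" for i
  proof -
    obtain t where "i = d + t" using \<open>\<not> i < d\<close> le_Suc_ex not_less by blast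
    then show ?thesis using that by (auto simp: N d_def)
  qed
  have "S' = four_block_mat L (0\<^sub>m d n) X D"
  proof (rule eq_matI)
    fix i j assume "i < dim_row (four_block_mat L (0\<^sub>m d n) X D)" "j < dim_col (four_block_mat L (0\<^sub>m d n) X D)"
    then have ij: "i < N" "j < N" using D by (auto simp: N L_def)
    show "S' $$ (i, j) = four_block_mat L (0\<^sub>m d n) X D $$ (i, j)"
    proof (cases "j < d")
      case True
      then show ?thesis using ij D by (auto simp: L_def X_def N)
    next
      case False
      then have j: "j - d < n" "S' $$ (i, j) = (M *\<^sub>v tensor_vec m n z (unit_vec n (j - d))) $ i"
        using ij Snth[of i "j - d"] by (auto simp: S'_def N F_def)
      note entry = rooted_mat_shift_tensor_vec[OF m Q unit_vec_carrier ij(1)[unfolded N_def],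
          of c z "j - d", folded M_def]
      show ?thesis
      proof (cases "i < d")
        case True
        then have a: "i div n < m - 1" by (simp add: d_def less_mult_imp_div_less)
        have "S' $$ (i, j) = 0"
        proof (cases "i div n")
          case 0
          then show ?thesis unfolding j(2) entry using a z0 by simp
        next
          case (Suc k)
          then show ?thesis unfolding j(2) entry using a zSS[of k] by (simp add: algebra_simps)
        qed
        then show ?thesis using ij True False D by (simp add: L_def N)
      next
        case i: False
        have "i div n = m - 1" "i mod n = i - d" "i - d < n" "m - 1 \<noteq> 0" 
          using last_block[OF ij(1) i] ij i N m by auto
        then have "S' $$ (i, j) = D $$ (i - d, j - d)"
          unfolding j(2) entry D_def using j(1) Q
          by (simp add: unit algebra_simps del: index_mult_mat_vec)
        then show ?thesis using ij i False D by (simp add: L_def N)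
      qed
    qed
  qed (use D in \<open>auto simp: S'_def N L_def\<close>)
  then have "det S' = det L * det D"
    using det_four_block_mat_upper_right_zero[of L d _ n X D] D by (simp add: L_def X_def)
  also have "det L = 1"
  proof (rule det_lower_unitriangular[where N = d])
    show "L \<in> carrier_mat d d" by (simp add: L_def)
    have Lnth: "L $$ (i, j) = (if i div n = j div n \<and> i mod n = j mod n then 1 else 0)"
      if "i \<le> j" "j < d" for i j
    proof -
      have n: "n > 0" using that by (cases n) (auto simp: d_def)
      have lt: "i < N" "j + n < N" "i < d" using that by (auto simp: N)
      have jn: "(j + n) div n = Suc (j div n)" "(j + n) mod n = j mod n" using n by auto
      have a: "i div n < m - 1" using lt by (simp add: d_def less_mult_imp_div_less)
      have le: "i div n \<le> j div n" using that by (simp add: div_le_mono)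
      have "L $$ (i, j) = (M *\<^sub>v block_vec m n (Suc (j div n)) (unit_vec n (j mod n))) $ i"
        using that lt Snth[of i "j + n"] n by (simp add: L_def S'_def F_def jn)
      also have "\<dots> = (if i div n = j div n \<and> i mod n = j mod n then 1 else 0)"
        unfolding block_vec_def M_def
        using a le n m
        by (subst rooted_mat_shift_tensor_vec[OF m Q unit_vec_carrier lt(1)[unfolded N_def]]) auto
      finally show ?thesis by simp
    qed
    show "L $$ (i, j) = 0" if "i < j" "j < d" for i j
    proof -
      have "i div n \<noteq> j div n \<or> i mod n \<noteq> j mod n"
        using that by (metis div_mult_mod_eq less_irrefl)
      then show ?thesis using Lnth[of i j] that by auto
    qed
    show "L $$ (i, i) = 1" if "i < d" for i
      using Lnth[of i i] that by simp
  qed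
  finally have "det S' = det D" by simp
  then show ?thesis
    using detM unfolding M_def Am D_def z_def by simp
qed

section \<open>Walk matrix of the block matrix\<close>

text \<open>
  At every root of \<open>g = q\<^sub>0 + \<dots> + q\<^sub>m\<^sub>-\<^sub>1\<close> one has \<open>B = - 1\<close> and \<open>A = 0\<close>, so each of the \<open>m - 1\<close> linear
  factors of \<open>g(T)\<close> contributes \<open>\<plusminus> det Q\<close>.
\<close>

lemma det_rooted_mat_sum_path_poly:
  fixes Q :: "complex mat"
  assumes m: "m \<ge> 2" and Q: "Q \<in> carrier_mat n n"
  shows "eq_up_to_sign (det (mat_poly (rooted_mat m n Q) (\<Sum>k\<le>m - 1. path_poly k))) (det Q ^ (m - 1))"
proof -
  let ?T = "rooted_mat m n Q" and ?p = "\<Sum>k\<le>m - 1. path_poly k :: complex poly"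
  obtain as where as: "Polynomial.smult (coeff ?p (degree ?p)) (\<Prod>a\<leftarrow>as. [:- a, 1:]) = ?p"
    "length as = degree ?p"
    using fundamental_theorem_algebra_factorized[of ?p] by blast
  then have p: "?p = (\<Prod>a\<leftarrow>as. [:- a, 1:])" and len: "length as = m - 1"
    by (simp_all add: degree_lead_coeff_sum_path_poly)
  have "eq_up_to_sign (det (mat_poly ?T [:- a, 1:])) (det Q)" if "a \<in> set as" for a
  proof -
    have root: "poly ?p a = 0"
      unfolding p using that by (induct as) auto
    have ev: "poly (path_poly (m - 1)) a = - 1" "poly (path_poly m) a = 1"
      using root_sum_path_poly[OF root] m by auto
    have "poly (path_poly (m - 1)) a \<cdot>\<^sub>m Q - poly (path_poly m + path_poly (m - 1)) a \<cdot>\<^sub>m 1\<^sub>m n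
        = (- 1) \<cdot>\<^sub>m Q"
      using Q unfolding poly_add ev by (intro eq_matI) auto
    then have "eq_up_to_sign (det (mat_poly ?T [:- a, 1:])) (det ((- 1) \<cdot>\<^sub>m Q))"
      using det_rooted_mat_shift[OF m Q, of a] by simp
    moreover have "eq_up_to_sign (det ((- 1) \<cdot>\<^sub>m Q)) (det Q)"
      unfolding det_smult by (rule eq_up_to_sign_neg_power)
    ultimately show ?thesis by (rule eq_up_to_sign_trans)
  qed
  then have "eq_up_to_sign (\<Prod>a\<leftarrow>as. det (mat_poly ?T [:- a, 1:])) (\<Prod>a\<leftarrow>as. det Q)"
    by (rule eq_up_to_sign_prod_list)
  also have "(\<Prod>a\<leftarrow>as. det Q) = det Q ^ (m - 1)"
    unfolding len[symmetric] by (induct as) auto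
  finally show ?thesis
    unfolding p det_mat_poly_linear_factors[OF rooted_mat_carrier] .
qed

text \<open>
  \<open>B(T)\<close> has determinant \<open>\<plusminus> 1\<close>: at a root \<open>a\<close> of \<open>B\<close> the block elimination leaves \<open>\<plusminus> q\<^sub>m(a)\<^sup>n\<close>, where
  \<open>q\<^sub>m(a)\<^sup>2 = a\<close>, and the product of the roots of \<open>B\<close> is \<open>1\<close>.
\<close>

lemma det_rooted_mat_path_poly:
  fixes Q :: "complex mat"
  assumes m: "m \<ge> 2" and Q: "Q \<in> carrier_mat n n"
  shows "eq_up_to_sign (det (mat_poly (rooted_mat m n Q) (path_poly (m - 1)))) 1"
proof -
  let ?T = "rooted_mat m n Q" and ?p = "path_poly (m - 1) :: complex poly"
  obtain as where as: "Polynomial.smult (coeff ?p (degree ?p)) (\<Prod>a\<leftarrow>as. [:- a, 1:]) = ?p"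
    "length as = degree ?p"
    using fundamental_theorem_algebra_factorized[of ?p] by blast
  then have p: "?p = (\<Prod>a\<leftarrow>as. [:- a, 1:])" and len: "length as = m - 1"
    by simp_all
  have root: "poly ?p a = 0" if "a \<in> set as" for a
    unfolding p using that by (induct as) auto
  let ?q = "\<lambda>a. poly (path_poly m) a"
  have "eq_up_to_sign (det (mat_poly ?T [:- a, 1:])) (?q a ^ n)" if "a \<in> set as" for a
  proof -
    have "poly (path_poly (m - 1)) a \<cdot>\<^sub>m Q - poly (path_poly m + path_poly (m - 1)) a \<cdot>\<^sub>m 1\<^sub>m n
        = (- ?q a) \<cdot>\<^sub>m 1\<^sub>m n"
      using Q root[OF that] by (intro eq_matI) auto
    then have "eq_up_to_sign (det (mat_poly ?T [:- a, 1:])) ((- 1) ^ n * ?q a ^ n)"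
      using det_rooted_mat_shift[OF m Q, of a] by (simp add: det_smult power_minus[of "?q a"])
    then show ?thesis using eq_up_to_sign_neg_power by (rule eq_up_to_sign_trans)
  qed
  then have "eq_up_to_sign (\<Prod>a\<leftarrow>as. det (mat_poly ?T [:- a, 1:])) (\<Prod>a\<leftarrow>as. ?q a ^ n)"
    by (rule eq_up_to_sign_prod_list)
  then have det: "eq_up_to_sign (det (mat_poly ?T ?p)) (\<Prod>a\<leftarrow>as. ?q a ^ n)"
    unfolding p det_mat_poly_linear_factors[OF rooted_mat_carrier] .
  \<comment> \<open>The square of the product of the \<open>q\<^sub>m(a)\<close> is the product of the roots.\<close>
  have "(\<Prod>a\<leftarrow>as. ?q a ^ n)\<^sup>2 = (\<Prod>a\<leftarrow>as. (?q a)\<^sup>2) ^ n"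
    by (induct as) (simp_all add: power_mult_distrib power_commutes flip: power_mult, simp add: mult.commute)
  also have "map (\<lambda>a. (?q a)\<^sup>2) as = as"
  proof (rule map_idI)
    fix a assume "a \<in> set as"
    then show "(?q a)\<^sup>2 = a" using root_path_poly[OF root] m by auto
  qed
  also have "prod_list as = 1"
  proof -
    have "poly (\<Prod>a\<leftarrow>bs. [:- a, 1:]) 0 = (- 1) ^ length bs * prod_list bs" for bs :: "complex list"
      by (induct bs) auto
    from this[of as] have "(- 1) ^ (m - 1) * prod_list as = (- 1) ^ (m - 1)"
      unfolding p[symmetric] poly_path_poly_0 len by simp
    then show ?thesis by simp
  qed
  finally have "(\<Prod>a\<leftarrow>as. ?q a ^ n)\<^sup>2 = 1" by simp
  then have "eq_up_to_sign (\<Prod>a\<leftarrow>as. ?q a ^ n) 1"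
    by (simp add: eq_up_to_sign_def power2_eq_1_iff)
  with det show ?thesis by (rule eq_up_to_sign_trans)
qed

lemma rooted_mat_root_relation_power:
  fixes Q :: "'a :: comm_ring_1 mat"
  assumes Q: "Q \<in> carrier_mat n n" and y: "y \<in> carrier_vec n" and m: "m \<ge> 2"
  shows "mat_poly (rooted_mat m n Q) ((path_poly m + path_poly (m - 1)) ^ j :: 'a poly) *\<^sub>v block_vec m n 0 y
     = mat_poly (rooted_mat m n Q) (path_poly (m - 1) ^ j) *\<^sub>v block_vec m n 0 (Q ^\<^sub>m j *\<^sub>v y)"
  using y
proof (induct j arbitrary: y)
  case 0
  then show ?case using Q by (simp add: mat_poly_1[OF rooted_mat_carrier])
next
  case (Suc j)
  let ?T = "rooted_mat m n Q" and ?A = "path_poly m + path_poly (m - 1) :: 'a poly"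
    and ?B = "path_poly (m - 1) :: 'a poly"
  have Qy: "Q *\<^sub>v y \<in> carrier_vec n" using Q Suc by auto
  note mult = mat_poly_mult_vec[OF rooted_mat_carrier block_vec_carrier]
  have "mat_poly ?T (?A ^ Suc j) *\<^sub>v block_vec m n 0 y
      = mat_poly ?T (?A ^ j) *\<^sub>v (mat_poly ?T ?B *\<^sub>v block_vec m n 0 (Q *\<^sub>v y))"
    unfolding power_Suc2 mult rooted_mat_root_relation[OF Q Suc(2) m] ..
  also have "\<dots> = mat_poly ?T ?B *\<^sub>v (mat_poly ?T (?A ^ j) *\<^sub>v block_vec m n 0 (Q *\<^sub>v y))"
    unfolding mult[symmetric] by (simp only: mult.commute)
  also have "\<dots> = mat_poly ?T (?B ^ Suc j) *\<^sub>v block_vec m n 0 (Q ^\<^sub>m j *\<^sub>v (Q *\<^sub>v y))"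
    unfolding Suc(1)[OF Qy] mult[symmetric] by simp
  also have "Q ^\<^sub>m j *\<^sub>v (Q *\<^sub>v y) = Q ^\<^sub>m Suc j *\<^sub>v y"
    using Q Suc(2) by (simp add: assoc_mult_mat_vec[of _ n n _ n])
  finally show ?case .
qed

text \<open>
  The basis polynomial \<open>A\<^sup>j B\<^sup>n\<^sup>-\<^sup>1\<^sup>-\<^sup>j q\<^sub>i\<close> sends \<open>e\<close> in the leaf block to \<open>Q\<^sup>j e\<close> in block \<open>i\<close>, apart from the
  factor \<open>B(T)\<^sup>n\<^sup>-\<^sup>1\<close>, which does not depend on \<open>i\<close> and \<open>j\<close>.
\<close>

lemma mat_poly_walk_basis:
  fixes Q :: "'a :: comm_ring_1 mat"
  assumes Q: "Q \<in> carrier_mat n n" and e: "e \<in> carrier_vec n" and m: "m \<ge> 2" and c: "c < m * n"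
  shows "mat_poly (rooted_mat m n Q) (walk_basis m n c) *\<^sub>v block_vec m n 0 e
     = mat_poly (rooted_mat m n Q) (path_poly (m - 1) ^ (n - 1))
         *\<^sub>v block_vec m n (c div n) (Q ^\<^sub>m (c mod n) *\<^sub>v e)"
proof -
  define i j where "i = c div n" and "j = c mod n"
  have i: "i < m" and j: "j < n" using div_mod_less[OF c] by (auto simp: i_def j_def)
  let ?T = "rooted_mat m n Q" and ?A = "path_poly m + path_poly (m - 1) :: 'a poly"
    and ?B = "path_poly (m - 1) :: 'a poly"
  have y: "Q ^\<^sub>m j *\<^sub>v e \<in> carrier_vec n" using Q e by (meson mult_mat_vec_carrier pow_carrier_mat)
  note mult = mat_poly_mult_vec[OF rooted_mat_carrier block_vec_carrier]
  have "walk_basis m n c = (path_poly i * ?B ^ (n - 1 - j)) * ?A ^ j"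
    by (simp add: walk_basis_def i_def j_def mult_ac)
  then have "mat_poly ?T (walk_basis m n c) *\<^sub>v block_vec m n 0 e
      = mat_poly ?T (path_poly i * ?B ^ (n - 1 - j)) *\<^sub>v (mat_poly ?T (?B ^ j) *\<^sub>v block_vec m n 0 (Q ^\<^sub>m j *\<^sub>v e))"
    by (simp only: mult rooted_mat_root_relation_power[OF Q e m])
  also have "\<dots> = mat_poly ?T (path_poly i * ?B ^ (n - 1 - j) * ?B ^ j) *\<^sub>v block_vec m n 0 (Q ^\<^sub>m j *\<^sub>v e)"
    unfolding mult ..
  also have "path_poly i * ?B ^ (n - 1 - j) * ?B ^ j = ?B ^ (n - 1) * path_poly i"
  proof -
    have "n - 1 = n - 1 - j + j" using j by simp
    then have "?B ^ (n - 1) = ?B ^ (n - 1 - j) * ?B ^ j" by (metis power_add)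
    then show ?thesis by (simp only: mult_ac)
  qed
  also have "mat_poly ?T \<dots> *\<^sub>v block_vec m n 0 (Q ^\<^sub>m j *\<^sub>v e)
      = mat_poly ?T (?B ^ (n - 1)) *\<^sub>v block_vec m n i (Q ^\<^sub>m j *\<^sub>v e)"
    unfolding mult rooted_mat_path_poly[OF Q y m i] ..
  finally show ?thesis unfolding i_def j_def .
qed

lemma of_int_walk_basis:
  "map_poly of_int (walk_basis m n c) = (walk_basis m n c :: 'a :: comm_ring_1 poly)"
  unfolding walk_basis_def of_int_poly_hom.hom_mult of_int_poly_hom.hom_power
    of_int_poly_hom.hom_add of_int_path_poly ..

lemma det_walk_mat_rooted_leaf:
  fixes Q :: "complex mat"
  assumes Q: "Q \<in> carrier_mat n n" and e: "e \<in> carrier_vec n" and m: "m \<ge> 2"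
  shows "eq_up_to_sign (det (walk_mat (rooted_mat m n Q) (block_vec m n 0 e))) (det (walk_mat Q e) ^ m)"
proof -
  define N where "N = m * n"
  let ?T = "rooted_mat m n Q" and ?B = "path_poly (m - 1) :: complex poly"
  let ?W = "walk_mat ?T (block_vec m n 0 e)"
  define U where "U = mat N N (\<lambda>(k, c). coeff (walk_basis m n c :: complex poly) k)"
  define UI where "UI = mat N N (\<lambda>(k, c). coeff (walk_basis m n c :: int poly) k)"
  \<comment> \<open>Up to the factor \<open>B(T)\<^sup>n\<^sup>-\<^sup>1\<close> the change of basis \<open>U\<close> turns the walk matrix into the block diagonal \<open>Y\<close>.\<close>
  define Y where "Y = mat_cols N (\<lambda>c. block_vec m n (c div n) (Q ^\<^sub>m (c mod n) *\<^sub>v e))"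
  have T: "?T \<in> carrier_mat N N" and v: "block_vec m n 0 e \<in> carrier_vec N" by (simp_all add: N_def)
  have "U = map_mat of_int UI"
    unfolding U_def UI_def
    by (intro eq_matI) (auto simp: of_int_walk_basis[symmetric, where ?'a = complex] coeff_map_poly)
  then have "det U = of_int (det UI)" by (simp add: of_int_hom.hom_det)
  moreover have "\<bar>det UI\<bar> = 1" unfolding UI_def N_def by (rule det_walk_basis[OF m])
  ultimately have detU: "eq_up_to_sign (det U) 1" by (auto simp: eq_up_to_sign_def abs_if split: if_splits)
  have Y: "det Y = det (walk_mat Q e) ^ m"
  proof -
    have "Y = mat (m * n) (m * n)
        (\<lambda>(r, c). if r div n = c div n then (Q ^\<^sub>m (c mod n) *\<^sub>v e) $ (r mod n) else 0)"
      unfolding Y_def N_def by (intro eq_matI) (auto simp: mat_cols_def block_vec_nth simp del: index_mult_mat_vec)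
    then have "det Y = det (mat_cols n (\<lambda>k. Q ^\<^sub>m k *\<^sub>v e)) ^ m"
      using det_block_diagonal[of m n "\<lambda>k. Q ^\<^sub>m k *\<^sub>v e"] by simp
    then show ?thesis using Q by (simp add: walk_mat_def)
  qed
  have "?W * U = mat_cols N (\<lambda>c. mat_poly ?T (walk_basis m n c) *\<^sub>v block_vec m n 0 e)"
    unfolding U_def using m by (intro walk_mat_mult_coeffs[OF T v]) (simp add: N_def degree_walk_basis)
  also have "\<dots> = mat_cols N (\<lambda>c. mat_poly ?T (?B ^ (n - 1)) *\<^sub>v block_vec m n (c div n) (Q ^\<^sub>m (c mod n) *\<^sub>v e))"
    by (rule mat_cols_cong) (simp add: mat_poly_walk_basis[OF Q e m] N_def)
  also have "\<dots> = mat_poly ?T (?B ^ (n - 1)) * Y"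
    unfolding Y_def by (rule mult_mat_cols[symmetric]) (use mat_poly_carrier[OF T] in \<open>simp_all add: N_def\<close>)
  finally have "det (?W * U) = det (mat_poly ?T (?B ^ (n - 1)) * Y)" by simp
  moreover have "?W \<in> carrier_mat N N" "U \<in> carrier_mat N N" "Y \<in> carrier_mat N N"
    by (simp_all add: walk_mat_def U_def Y_def N_def)
  ultimately have prod: "det ?W * det U = det (mat_poly ?T ?B) ^ (n - 1) * det (walk_mat Q e) ^ m"
    using mat_poly_carrier[OF T] by (simp add: det_mult[of _ N] det_mat_poly_power[OF T] Y)
  have "eq_up_to_sign (det (mat_poly ?T ?B) ^ (n - 1)) 1"
    using eq_up_to_sign_power[OF det_rooted_mat_path_poly[OF m Q], of "n - 1"] by simp
  then have "eq_up_to_sign (det ?W * det U) (det (walk_mat Q e) ^ m)"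
    unfolding prod by (auto simp: eq_up_to_sign_def)
  moreover have "eq_up_to_sign (det ?W) (det ?W * det U)"
    using detU by (auto simp: eq_up_to_sign_def)
  ultimately show ?thesis by (blast intro: eq_up_to_sign_trans)
qed

lemma det_walk_mat_rooted:
  fixes Q :: "complex mat"
  assumes Q: "Q \<in> carrier_mat n n" and e: "e \<in> carrier_vec n" and m: "m \<ge> 2"
  shows "eq_up_to_sign (det (walk_mat (rooted_mat m n Q) (tensor_vec m n (\<lambda>_. 1) e)))
    (det Q ^ (m - 1) * det (walk_mat Q e) ^ m)"
proof -
  let ?T = "rooted_mat m n Q" and ?g = "\<Sum>k\<le>m - 1. path_poly k :: complex poly"
  have "walk_mat ?T (tensor_vec m n (\<lambda>_. 1) e) = mat_poly ?T ?g * walk_mat ?T (block_vec m n 0 e)"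
    unfolding rooted_mat_sum_path_poly[OF Q e m, symmetric]
    by (rule walk_mat_mat_poly[OF rooted_mat_carrier block_vec_carrier])
  moreover have "walk_mat ?T (block_vec m n 0 e) \<in> carrier_mat (m * n) (m * n)"
    by (simp add: walk_mat_def)
  ultimately have "det (walk_mat ?T (tensor_vec m n (\<lambda>_. 1) e))
      = det (mat_poly ?T ?g) * det (walk_mat ?T (block_vec m n 0 e))"
    using det_mult[OF mat_poly_carrier[OF rooted_mat_carrier]] by simp
  then show ?thesis
    using eq_up_to_sign_mult[OF det_rooted_mat_sum_path_poly[OF m Q] det_walk_mat_rooted_leaf[OF Q e m]]
    by simp
qed

section \<open>Rooted products of graphs with paths\<close>

lemma out_degree_rooted_product:
  assumes "pair_graph G" "pair_graph H" and i: "i \<in> pverts G"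
  shows "out_degree (with_proj (rooted_product G H r)) (i, a)
    = out_degree (with_proj H) a + (if a = r then out_degree (with_proj G) i else 0)"
proof -
  interpret G: pair_graph G by fact
  interpret H: pair_graph H by fact
  let ?A = "(\<lambda>e. ((i, fst e), (i, snd e))) ` {e \<in> parcs H. fst e = a}"
  let ?B = "if a = r then (\<lambda>e. ((fst e, r), (snd e, r))) ` {e \<in> parcs G. fst e = i} else {}"
  have "{e \<in> parcs (rooted_product G H r). fst e = (i, a)} = ?A \<union> ?B"
    using i by (force simp: rooted_product_def)
  moreover have "card ?A = card {e \<in> parcs H. fst e = a}"
    by (rule card_image) (auto simp: inj_on_def prod_eq_iff)
  moreover have "card ?B = (if a = r then card {e \<in> parcs G. fst e = i} else 0)"
    by (auto simp: inj_on_def prod_eq_iff intro!: card_image)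
  moreover have "?A \<inter> ?B = {}"
    using G.pair_no_loops by auto
  moreover have "finite ?A" "finite ?B" using G.pair_finite_arcs H.pair_finite_arcs by auto
  ultimately show ?thesis
    by (simp add: out_degree_def out_arcs_def card_Un_disjoint del: Un_iff)
qed

lemma out_degree_path_graph:
  assumes "m \<ge> 2" "a \<in> {1..m}"
  shows "out_degree (with_proj (path_graph m)) a = (if a = 1 \<or> a = m then 1 else 2)"
proof -
  have "{e \<in> parcs (path_graph m). fst e = a}
      = (if a < m then {(a, a + 1)} else {}) \<union> (if a > 1 then {(a, a - 1)} else {})"
    using assms by (auto simp: path_graph_def)
  then show ?thesis using assms by (auto simp: out_degree_def out_arcs_def)
qed

lemma signless_laplacian_dim [simp]:
  "signless_laplacian H vs \<in> carrier_mat (length vs) (length vs)"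
  "dim_row (signless_laplacian H vs) = length vs" "dim_col (signless_laplacian H vs) = length vs"
  by (auto simp: signless_laplacian_def adj_mat_def degree_mat_def mat_diag_def)

lemma signless_laplacian_nth:
  "i < length vs \<Longrightarrow> j < length vs \<Longrightarrow> signless_laplacian H vs $$ (i, j) =
    (if (vs ! i, vs ! j) \<in> parcs H then 1 else 0)
    + (if i = j then real (out_degree (with_proj H) (vs ! i)) else 0)"
  by (auto simp: signless_laplacian_def adj_mat_def degree_mat_def mat_diag_def)

lemma Q_walk_mat_eq_walk_mat:
  "Q_walk_mat H vs = walk_mat (signless_laplacian H vs) (all_ones (length vs))"
  by (intro eq_matI) (auto simp: Q_walk_mat_def walk_mat_def mat_cols_def mat_of_cols_index)

text \<open>
  A simultaneous permutation of the rows and columns of \<open>M\<close> and of the entries of \<open>v\<close> only permutes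
  the rows of the walk matrix.
\<close>

lemma det_walk_mat_permute:
  fixes M M' :: "'a :: comm_ring_1 mat"
  assumes M: "M \<in> carrier_mat N N" and v: "v \<in> carrier_vec N"
    and M': "M' \<in> carrier_mat N N" and v': "v' \<in> carrier_vec N"
    and p: "p permutes {0..<N}"
    and MM: "\<And>i j. i < N \<Longrightarrow> j < N \<Longrightarrow> M' $$ (i, j) = M $$ (p i, p j)"
    and vv: "\<And>i. i < N \<Longrightarrow> v' $ i = v $ p i"
  shows "eq_up_to_sign (det (walk_mat M' v')) (det (walk_mat M v))"
proof -
  have pN: "p i < N" if "i < N" for i
    using permutes_in_image[OF p, of i] that by simp
  have walk: "(M' ^\<^sub>m k *\<^sub>v w') $ i = (M ^\<^sub>m k *\<^sub>v w) $ p i"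
    if "w \<in> carrier_vec N" "w' \<in> carrier_vec N" "\<And>i. i < N \<Longrightarrow> w' $ i = w $ p i" "i < N" for k w w' i
    using that
  proof (induct k arbitrary: w w' i)
    case 0
    then show ?case using M M' by simp
  next
    case (Suc k)
    have step: "(M' *\<^sub>v w') $ i = (M *\<^sub>v w) $ p i" if i: "i < N" for i
    proof -
      have "(M' *\<^sub>v w') $ i = (\<Sum>j\<in>{0..<N}. M $$ (p i, p j) * w $ p j)"
        using i M' Suc(3,4) by (simp add: scalar_prod_def MM)
      also have "\<dots> = (\<Sum>j\<in>{0..<N}. M $$ (p i, j) * w $ j)"
        by (rule sum.permute[OF p, symmetric, unfolded comp_def])
      also have "\<dots> = (M *\<^sub>v w) $ p i"
        using pN[OF i] M Suc(2) by (simp add: scalar_prod_def)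
      finally show ?thesis .
    qed
    have carr: "M *\<^sub>v w \<in> carrier_vec N" "M' *\<^sub>v w' \<in> carrier_vec N"
      using M M' Suc(2,3) by auto
    show ?case
      using Suc(1)[OF carr step Suc(5)] M M' Suc(2,3)
      by (simp add: assoc_mult_mat_vec[of _ N N _ N])
  qed
  have "walk_mat M' v' = mat N N (\<lambda>(i, j). walk_mat M v $$ (p i, j))"
    using M M' walk[OF v v' vv] pN
    by (intro eq_matI) (auto simp: walk_mat_def mat_cols_def simp del: index_mult_mat_vec)
  moreover have "walk_mat M v \<in> carrier_mat N N" using M by (simp add: walk_mat_def)
  ultimately have "det (walk_mat M' v') = signof p * det (walk_mat M v)"
    using det_permute_rows[OF _ p] by simp
  then show ?thesis
    by (cases rule: sign_cases[of p]) (auto simp: eq_up_to_sign_def)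
qed

lemma det_Q_walk_mat_enum:
  assumes "vertex_enum H vs" "vertex_enum H vs'"
  shows "eq_up_to_sign (det (Q_walk_mat H vs')) (det (Q_walk_mat H vs))"
proof -
  have "mset vs' = mset vs"
    using assms by (auto simp: vertex_enum_def set_eq_iff_mset_eq_distinct[symmetric])
  then obtain p where p: "p permutes {..<length vs}" "permute_list p vs = vs'"
    by (rule mset_eq_permutation)
  define N where "N = length vs"
  have len: "length vs' = N" using p(2) by (auto simp: N_def)
  have p': "p permutes {0..<N}" using p(1) by (simp add: N_def lessThan_atLeast0)
  have nth: "vs' ! i = vs ! p i" if "i < N" for i
    using permute_list_nth[OF p(1)] that p(2) by (auto simp: N_def)
  have pN: "p i < N" if "i < N" for i
    using permutes_in_image[OF p', of i] that by simp
  have inj: "p i = p j \<longleftrightarrow> i = j" for i j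
    using permutes_inj[OF p'] by (auto simp: inj_def)
  have lap: "signless_laplacian H vs' $$ (i, j) = signless_laplacian H vs $$ (p i, p j)"
    if "i < N" "j < N" for i j
    using that pN len by (simp add: signless_laplacian_nth N_def[symmetric] nth inj)
  show ?thesis
    unfolding Q_walk_mat_eq_walk_mat
  proof (rule det_walk_mat_permute[OF _ _ _ _ p' lap])
    show "signless_laplacian H vs \<in> carrier_mat N N" "signless_laplacian H vs' \<in> carrier_mat N N"
      using signless_laplacian_dim(1) len N_def by metis+
  qed (use len pN in \<open>auto simp: all_ones_def N_def\<close>)
qed

text \<open>
  The enumeration of the vertices of \<open>G \<circ> P\<^sub>m\<close> that matches the block form above: block \<open>b\<close> consists of
  the vertices \<open>(1, m - b), \<dots>, (n, m - b)\<close>, because the path vertex \<open>1\<close> is the root and \<open>m\<close> the leaf.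
\<close>

definition leaf_first_enum :: "nat \<Rightarrow> nat \<Rightarrow> (nat \<times> nat) list" where
  "leaf_first_enum m n = map (\<lambda>r. (Suc (r mod n), m - r div n)) [0..<m * n]"

lemma vertex_enum_leaf_first:
  assumes "pverts G = {1..n}"
  shows "vertex_enum (rooted_product G (path_graph m) 1) (leaf_first_enum m n)"
  unfolding vertex_enum_def
proof
  show "distinct (leaf_first_enum m n)"
    unfolding leaf_first_enum_def distinct_map
  proof (intro conjI inj_onI)
    fix x y assume xy: "x \<in> set [0..<m * n]" "y \<in> set [0..<m * n]"
      and "(Suc (x mod n), m - x div n) = (Suc (y mod n), m - y div n)"
    then have "x mod n = y mod n" "m - x div n = m - y div n" by auto
    moreover have "x div n < m" "y div n < m" using div_mod_less xy by auto
    ultimately have "x div n = y div n" "x mod n = y mod n" by linarith+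
    then show "x = y" by (metis div_mult_mod_eq)
  qed simp
  show "set (leaf_first_enum m n) = pverts (rooted_product G (path_graph m) 1)"
  proof (rule Set.set_eqI)
    fix x :: "nat \<times> nat"
    obtain i a where x: "x = (i, a)" by (cases x)
    have "x \<in> set (leaf_first_enum m n)" if "i \<in> {1..n}" "a \<in> {1..m}"
    proof -
      define r where "r = (m - a) * n + (i - 1)"
      have "i - 1 < n" using that by auto
      then have "r div n = m - a" "r mod n = i - 1" unfolding r_def by simp_all
      moreover have "r < m * n"
      proof -
        have "r < Suc (m - a) * n" using \<open>i - 1 < n\<close> by (simp add: r_def)
        also have "\<dots> \<le> m * n" by (rule mult_le_mono1) (use that in auto)
        finally show ?thesis .
      qed
      ultimately show ?thesis
        using that unfolding x leaf_first_enum_def set_map by (intro image_eqI[of _ _ r]) auto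
    qed
    moreover have "i \<in> {1..n} \<and> a \<in> {1..m}" if mem: "x \<in> set (leaf_first_enum m n)"
    proof -
      obtain r where "(i, a) = (Suc (r mod n), m - r div n)" "r \<in> set [0..<m * n]"
        using mem unfolding x leaf_first_enum_def set_map by (rule imageE)
      then have ia: "i = Suc (r mod n)" "a = m - r div n" and r: "r < m * n" by simp_all
      have "Suc p \<in> {1..n} \<and> m - q \<in> {1..m}" if "p < n" "q < m" for p q
        using that by auto
      from this[OF div_mod_less(2,1)[OF r]] show ?thesis by (simp only: ia)
    qed
    moreover have "x \<in> pverts (rooted_product G (path_graph m) 1) \<longleftrightarrow> i \<in> {1..n} \<and> a \<in> {1..m}"
      unfolding x by (simp add: rooted_product_def path_graph_def assms)
    ultimately show "x \<in> set (leaf_first_enum m n) \<longleftrightarrow> x \<in> pverts (rooted_product G (path_graph m) 1)"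
      by blast
  qed
qed

lemma signless_laplacian_rooted_product:
  assumes G: "pair_graph G" and V: "pverts G = {1..n}" and m: "m \<ge> 2"
  shows "signless_laplacian (rooted_product G (path_graph m) 1) (leaf_first_enum m n)
    = rooted_mat m n (signless_laplacian G [1..<n + 1])"
proof (rule eq_matI)
  let ?R = "rooted_product G (path_graph m) 1" and ?vs = "leaf_first_enum m n"
  interpret G: pair_graph G by fact
  have len: "length ?vs = m * n" by (simp add: leaf_first_enum_def)
  fix r c assume "r < dim_row (rooted_mat m n (signless_laplacian G [1..<n + 1]))"
    "c < dim_col (rooted_mat m n (signless_laplacian G [1..<n + 1]))"
  then have rc: "r < m * n" "c < m * n" by simp_all
  define a b i j where "a = r div n" and "b = c div n" and "i = r mod n" and "j = c mod n"
  have ab: "a < m" "b < m" and ij: "i < n" "j < n"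
    using div_mod_less rc by (auto simp: a_def b_def i_def j_def)
  have rc_eq: "r = c \<longleftrightarrow> a = b \<and> i = j"
    unfolding a_def b_def i_def j_def by (metis div_mult_mod_eq)
  have nth: "?vs ! r = (Suc i, m - a)" "?vs ! c = (Suc j, m - b)"
    using rc by (simp_all add: leaf_first_enum_def a_def b_def i_def j_def)
  have loop: "(x, x) \<notin> parcs G" for x using G.pair_no_loops by fastforce
  \<comment> \<open>The root, path vertex \<open>1\<close>, sits in block \<open>m - 1\<close>.\<close>
  have root: "m - x = 1 \<longleftrightarrow> x = m - 1" if "x < m" for x using that by auto
  have arc: "((Suc i, m - a), (Suc j, m - b)) \<in> parcs ?R \<longleftrightarrow>
      i = j \<and> (a = Suc b \<or> b = Suc a) \<or> a = b \<and> a = m - 1 \<and> (Suc i, Suc j) \<in> parcs G"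
  proof -
    have "((Suc i, m - a), (Suc j, m - b)) \<in> parcs ?R \<longleftrightarrow>
      i = j \<and> (m - a, m - b) \<in> parcs (path_graph m) \<or> (m - a = 1 \<and> m - b = 1) \<and> (Suc i, Suc j) \<in> parcs G"
      using ij V by (auto simp: rooted_product_def)
    also have "(m - a, m - b) \<in> parcs (path_graph m) \<longleftrightarrow> a = Suc b \<or> b = Suc a"
      unfolding path_graph_def using ab by simp arith
    also have "m - a = 1 \<and> m - b = 1 \<longleftrightarrow> a = b \<and> a = m - 1"
      using ab by arith
    finally show ?thesis by blast
  qed
  have deg: "out_degree (with_proj ?R) (Suc i, m - a)
      = (if a = 0 \<or> a = m - 1 then 1 else 2) + (if a = m - 1 then out_degree (with_proj G) (Suc i) else 0)"
    using ab ij V m root[OF ab(1)]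
    by (subst out_degree_rooted_product[OF G pair_graph_path_graph])
      (auto simp: out_degree_path_graph)
  have lap: "signless_laplacian G [1..<n + 1] $$ (i, j) = (if (Suc i, Suc j) \<in> parcs G then 1 else 0)
      + (if i = j then real (out_degree (with_proj G) (Suc i)) else 0)"
    using ij by (subst signless_laplacian_nth) (simp_all del: upt_Suc)
  have "signless_laplacian ?R ?vs $$ (r, c) = (if ((Suc i, m - a), (Suc j, m - b)) \<in> parcs ?R then 1 else 0)
      + (if a = b \<and> i = j then real (out_degree (with_proj ?R) (Suc i, m - a)) else 0)"
    using rc by (subst signless_laplacian_nth) (simp_all add: len nth rc_eq)
  also have "\<dots> = (if a = b \<and> a = m - 1 then signless_laplacian G [1..<n + 1] $$ (i, j) else 0)
      + (if i = j then path_coeff m a b else 0)"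
    unfolding arc deg lap path_coeff_def using loop[of "Suc i"] by auto
  finally show "signless_laplacian ?R ?vs $$ (r, c)
      = rooted_mat m n (signless_laplacian G [1..<n + 1]) $$ (r, c)"
    using rc by (simp add: rooted_mat_def a_def b_def i_def j_def)
qed (simp_all add: leaf_first_enum_def)

lemma of_real_walk_mat:
  assumes M: "M \<in> carrier_mat N N" and v: "v \<in> carrier_vec N"
  shows "map_mat complex_of_real (walk_mat M v) = walk_mat (map_mat of_real M) (map_vec of_real v)"
proof -
  have "map_mat complex_of_real M ^\<^sub>m k *\<^sub>v map_vec of_real v = map_vec of_real (M ^\<^sub>m k *\<^sub>v v)" for k
    unfolding of_real_hom.mat_hom_pow[OF M, symmetric]
    by (rule of_real_hom.mult_mat_vec_hom[OF pow_carrier_mat[OF M] v, symmetric])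
  then show ?thesis
    using M v by (intro eq_matI) (auto simp: walk_mat_def mat_cols_def simp del: index_mult_mat_vec)
qed

lemma of_real_rooted_mat:
  assumes "Q \<in> carrier_mat n n"
  shows "map_mat complex_of_real (rooted_mat m n Q) = rooted_mat m n (map_mat of_real Q)"
  using assms by (intro eq_matI) (auto simp: rooted_mat_def path_coeff_def dest!: div_mod_less)

theorem theorem2:
  fixes G :: "nat pair_pre_digraph" and n m :: nat and vs :: "(nat \<times> nat) list"
  assumes "pair_graph G" and "pverts G = {1..n}" and "m \<ge> 2"
    and "vertex_enum (rooted_product G (path_graph m) 1) vs"
  shows "det (Q_walk_mat (rooted_product G (path_graph m) 1) vs) =
           det (signless_laplacian G [1..<n + 1]) ^ (m - 1) * det (Q_walk_mat G [1..<n + 1]) ^ m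
       \<or> det (Q_walk_mat (rooted_product G (path_graph m) 1) vs) =
           - (det (signless_laplacian G [1..<n + 1]) ^ (m - 1) * det (Q_walk_mat G [1..<n + 1]) ^ m)"
proof -
  define Q where "Q = signless_laplacian G [1..<n + 1]"
  let ?R = "rooted_product G (path_graph m) 1"
  let ?QC = "map_mat complex_of_real Q" and ?e = "all_ones n"
  have Q: "Q \<in> carrier_mat n n"
    unfolding Q_def using signless_laplacian_dim(1)[of G "[1..<n + 1]"] by (simp del: upt_Suc)
  have e: "?e \<in> carrier_vec n" by (simp add: all_ones_def)
  have WG: "Q_walk_mat G [1..<n + 1] = walk_mat Q ?e"
    unfolding Q_walk_mat_eq_walk_mat Q_def by (simp del: upt_Suc)
  have "Q_walk_mat ?R (leaf_first_enum m n) = walk_mat (rooted_mat m n Q) (all_ones (m * n))"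
    unfolding Q_walk_mat_eq_walk_mat signless_laplacian_rooted_product[OF assms(1-3)] Q_def
    by (simp add: leaf_first_enum_def del: upt_Suc)
  \<comment> \<open>Over the complex numbers, where \<open>det_walk_mat_rooted\<close> applies, the determinants are unchanged.\<close>
  then have "map_mat complex_of_real (Q_walk_mat ?R (leaf_first_enum m n))
      = walk_mat (rooted_mat m n ?QC) (map_vec of_real (all_ones (m * n)))"
    using of_real_walk_mat[OF rooted_mat_carrier[of m n Q], of "all_ones (m * n)"]
    by (simp add: of_real_rooted_mat[OF Q] all_ones_def)
  also have "map_vec complex_of_real (all_ones (m * n)) = tensor_vec m n (\<lambda>_. 1) (map_vec of_real ?e)"
    by (intro eq_vecI) (auto simp: all_ones_def tensor_vec_def dest: div_mod_less)
  finally have "complex_of_real (det (Q_walk_mat ?R (leaf_first_enum m n)))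
      = det (walk_mat (rooted_mat m n ?QC) (tensor_vec m n (\<lambda>_. 1) (map_vec of_real ?e)))"
    by (metis of_real_hom.hom_det)
  moreover have "det ?QC ^ (m - 1) * det (walk_mat ?QC (map_vec of_real ?e)) ^ m
      = complex_of_real (det Q ^ (m - 1) * det (walk_mat Q ?e) ^ m)"
    unfolding of_real_walk_mat[OF Q e, symmetric] by simp
  moreover have "eq_up_to_sign (det (walk_mat (rooted_mat m n ?QC) (tensor_vec m n (\<lambda>_. 1) (map_vec of_real ?e))))
      (det ?QC ^ (m - 1) * det (walk_mat ?QC (map_vec of_real ?e)) ^ m)"
    by (rule det_walk_mat_rooted) (use Q e assms(3) in auto)
  ultimately have "eq_up_to_sign (complex_of_real (det (Q_walk_mat ?R (leaf_first_enum m n))))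
      (complex_of_real (det Q ^ (m - 1) * det (walk_mat Q ?e) ^ m))"
    by (simp only:)
  then have "eq_up_to_sign (det (Q_walk_mat ?R (leaf_first_enum m n)))
      (det Q ^ (m - 1) * det (walk_mat Q ?e) ^ m)"
    unfolding eq_up_to_sign_def of_real_minus[symmetric] of_real_eq_iff .
  moreover have "eq_up_to_sign (det (Q_walk_mat ?R vs)) (det (Q_walk_mat ?R (leaf_first_enum m n)))"
    by (rule det_Q_walk_mat_enum[OF vertex_enum_leaf_first[OF assms(2)] assms(4)])
  ultimately show ?thesis
    unfolding eq_up_to_sign_def[symmetric] WG Q_def[symmetric] by (blast intro: eq_up_to_sign_trans)
qed

end
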